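(* Let $\Gamma$ be a ribbon graph of a connected trivalent graph $G(V,E)$ that has a quadrilateral face whose four emanating edges (spokes) $s_1,s_2,s_3,s_4$, listed in clockwise order around the face, are pairwise distinct edges of $\Gamma$. Let $\Gamma_{\square}=\Gamma$, and let $\Gamma_{H},\Gamma_{I},\Gamma_{\parallel},\Gamma_{=},\Gamma_{\times},\Gamma_{\bullet}$ be the ribbon graphs obtained from $\Gamma$ by replacing the quadrilateral by, respectively, the following configurations on the same four spoke ends: - $H$: two trivalent vertices joined by one untwisted edge $f$, with clockwise orders $(s_1,s_2,f)$ and $(s_3,s_4,f)$; - $I$: two trivalent vertices joined by one untwisted edge $f$, with clockwise orders $(s_2,s_3,f)$ and $(s_4,s_1,f)$; - $\parallel$: no vertices; $s_1$ is joined to $s_4$ and $s_2$ is joined to $s_3$; - $=$: no vertices; $s_1$ is joined to $s_2$ and $s_3$ is joined to $s_4$; - $\times$: no vertices; $s_1$ is joined to $s_3$ and $s_2$ is joined to $s_4$ (a virtual crossing); - $\bullet$: one $4$-valent vertex with clockwise order $(s_1,s_2,s_3,s_4)$. Then the Penrose polynomials evaluated at $n=4$ satisfy $$[\Gamma_{\square}]_4 = 2[\Gamma_{H}]_4+2[\Gamma_{I}]_4+4[\Gamma_{\parallel}]_4+4[\Gamma_{=}]_4+4[\Gamma_{\times}]_4-4[\Gamma_{\bullet}]_4 .$$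
   Context: Ribbon graphs. A ribbon graph $\Gamma$ of a finite graph $G(V,E)$ (loops and multiple edges allowed) is a compact surface with boundary made of a disc for each vertex and a ribbon (band) for each edge, attached to the vertex discs; $\overline\Gamma$ denotes the closed surface obtained by capping the boundary circles (faces) with discs. It is presented by a cyclic order of half-edges at each vertex together with a label "untwisted" or "half-twisted" on each edge. In plane diagrams, edges may cross each other in virtual crossings, which carry no information. Penrose polynomial. For a trivalent graph with a perfect matching $M$, the bracket $[\Gamma_M]_n$ of the perfect matching graph $\Gamma_M$ is computed by replacing each matching edge by the difference (0-smoothing) $-$ (1-smoothing): the 0-smoothing deletes the edge and joins the four remaining strands along the two sides of its ribbon; the 1-smoothing joins them along the two sides of the ribbon after inserting an extra half-twist (so the two strands cross). A closed circle has value $n$ (multiplicatively). For an arbitrary ribbon graph $\Gamma$, the blowup $\Gamma_E^\flat$ replaces each vertex of degree $d$ by a $d$-cycle (the boundary of the vertex disc), with canonical perfect matching the original edge set $E$, and $[\Gamma]_n:=[\Gamma_E^\flat]_n$. Explicitly, $[\Gamma]_n=\sum_{A\subseteq E}(-1)^{|A|}n^{b(A)}$, where $b(A)$ is the number of boundary circles of the ribbon surface obtained from $\Gamma$ by inserting an extra half-twist in the ribbon of each edge of $A$. The graphs need not be connected or trivalent for this definition. Quadrilateral and replacement. A quadrilateral face with its emanating edges means: trivalent vertices $v_1,\dots,v_4$ (indices mod 4), untwisted edges $c_i$ from $v_i$ to $v_{i+1}$, and spokes $s_i$ at $v_i$, with clockwise order $(s_i,c_i,c_{i-1})$ at $v_i$,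 so that the cycle $c_1c_2c_3c_4$ bounds a face disc. The configuration (the $v_i$ and $c_i$) lies in a disc whose boundary meets the spokes at four points in clockwise order $s_1,\dots,s_4$. Replacing the configuration changes only the inside of this disc. When two spokes are joined, they become a single edge whose half-twist is the sum modulo 2 of the half-twists of the two spokes. *)

theory Defs
  imports "HOL-Computational_Algebra.Polynomial"
begin

(* A ribbon graph is presented by its half-edges: base h is the vertex at which h starts,
   nxt h is the half-edge that follows h in clockwise order around that vertex, opp h is the other
   half of the same edge, and twist h says whether that edge is half-twisted. *)

record ('v, 'h) rgraph =
  verts :: "'v set"
  halfs :: "'h set"
  base :: "'h \<Rightarrow> 'v"
  nxt :: "'h \<Rightarrow> 'h"
  opp :: "'h \<Rightarrow> 'h"
  twist :: "'h \<Rightarrow> bool"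

locale ribbon_graph =
  fixes G :: "('v, 'h) rgraph"
  assumes finite_verts: "finite (verts G)"
    and finite_halfs: "finite (halfs G)"
    and base_in: "h \<in> halfs G \<Longrightarrow> base G h \<in> verts G"
    and nxt_bij: "bij_betw (nxt G) (halfs G) (halfs G)"
    and base_nxt: "h \<in> halfs G \<Longrightarrow> base G (nxt G h) = base G h"
    and nxt_cyclic: "\<lbrakk>h \<in> halfs G; k \<in> halfs G; base G h = base G k\<rbrakk> \<Longrightarrow> \<exists>i. (nxt G ^^ i) h = k"
    and opp_in: "h \<in> halfs G \<Longrightarrow> opp G h \<in> halfs G"
    and opp_neq: "h \<in> halfs G \<Longrightarrow> opp G h \<noteq> h"
    and opp_opp: "h \<in> halfs G \<Longrightarrow> opp G (opp G h) = h"
    and twist_opp: "h \<in> halfs G \<Longrightarrow> twist G (opp G h) = twist G h"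

definition edge_of :: "('v, 'h) rgraph \<Rightarrow> 'h \<Rightarrow> 'h set" where
  "edge_of G h = {h, opp G h}"

definition edges :: "('v, 'h) rgraph \<Rightarrow> 'h set set" where
  "edges G = edge_of G ` halfs G"

definition trivalent :: "('v, 'h) rgraph \<Rightarrow> bool" where
  "trivalent G \<longleftrightarrow> (\<forall>v \<in> verts G. card {h \<in> halfs G. base G h = v} = 3)"

definition connected_graph :: "('v, 'h) rgraph \<Rightarrow> bool" where
  "connected_graph G \<longleftrightarrow> verts G \<noteq> {} \<and>
     (\<forall>u \<in> verts G. \<forall>v \<in> verts G. (u, v) \<in> {(base G h, base G (opp G h)) | h. h \<in> halfs G}\<^sup>*)"

definition perfect_matching :: "('v, 'h) rgraph \<Rightarrow> 'h set set \<Rightarrow> bool" where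
  "perfect_matching G M \<longleftrightarrow> M \<subseteq> edges G \<and> (\<forall>v \<in> verts G. \<exists>!h. h \<in> \<Union>M \<and> base G h = v)"


(* Bracket of a trivalent ribbon graph G with perfect matching M. In the state A the edges of A are
   1-smoothed and the other edges of M are 0-smoothed. What remains are the half-edges outside M.
   At a matching half-edge m the strand leaving on the clockwise side of m is nxt m and the one on
   the other side is nxt (nxt m), by trivalence. Along an untwisted ribbon the clockwise side of m
   runs to the counterclockwise side of opp m; a half-twist, whether of the edge itself or inserted
   by the 1-smoothing, exchanges the sides. The circles are the classes of half-edges generated
   by these joins. *)

definition smoothing_joins :: "('v, 'h) rgraph \<Rightarrow> 'h set set \<Rightarrow> 'h set set \<Rightarrow> 'h rel" where
  "smoothing_joins G M A =
     {(h, opp G h) | h. h \<in> halfs G - \<Union>M} \<union>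
     (\<Union>m \<in> \<Union>M. let m' = opp G m in
        if twist G m \<noteq> (edge_of G m \<in> A)
        then {(nxt G m, nxt G m'), (nxt G (nxt G m), nxt G (nxt G m'))}
        else {(nxt G m, nxt G (nxt G m')), (nxt G (nxt G m), nxt G m')})"

definition circles :: "('v, 'h) rgraph \<Rightarrow> 'h set set \<Rightarrow> 'h set set \<Rightarrow> nat" where
  "circles G M A =
     (let J = smoothing_joins G M A in card ((halfs G - \<Union>M) // (J \<union> J\<inverse>)\<^sup>*))"

definition bracket :: "('v, 'h) rgraph \<Rightarrow> 'h set set \<Rightarrow> int poly" where
  "bracket G M = (\<Sum>A \<in> Pow M. (-1) ^ card A * monom 1 (circles G M A))"


(* The blowup has one vertex for each half-edge h of G, lying on the boundary circle of the vertex
   disc where h is attached. It carries the matching half-edge (h, Spoke), which is h itself, and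
   the half-edges (h, Fwd) and (h, Bwd) of the circle towards the clockwise and the counterclockwise
   neighbour of h. *)

datatype port = Spoke | Fwd | Bwd

definition blowup :: "('v, 'h) rgraph \<Rightarrow> ('h, 'h \<times> port) rgraph" where
  "blowup G = \<lparr>
     verts = halfs G,
     halfs = halfs G \<times> UNIV,
     base = fst,
     nxt = (\<lambda>(h, p). (h, case p of Spoke \<Rightarrow> Fwd | Fwd \<Rightarrow> Bwd | Bwd \<Rightarrow> Spoke)),
     opp = (\<lambda>(h, p). case p of
               Spoke \<Rightarrow> (opp G h, Spoke)
             | Fwd \<Rightarrow> (nxt G h, Bwd)
             | Bwd \<Rightarrow> (inv_into (halfs G) (nxt G) h, Fwd)),
     twist = (\<lambda>(h, p). p = Spoke \<and> twist G h) \<rparr>"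

definition blowup_matching :: "('v, 'h) rgraph \<Rightarrow> ('h \<times> port) set set" where
  "blowup_matching G = (\<lambda>h. edge_of (blowup G) (h, Spoke)) ` halfs G"

lemma (in ribbon_graph) blowup_wf:
  shows "ribbon_graph (blowup G)"
    and "trivalent (blowup G)"
    and "perfect_matching (blowup G) (blowup_matching G)"
proof -
  have inv_in: "inv_into (halfs G) (nxt G) h \<in> halfs G" if "h \<in> halfs G" for h
    using that nxt_bij by (metis bij_betw_imp_surj_on inv_into_into)
  have nxt_in: "nxt G h \<in> halfs G" if "h \<in> halfs G" for h
    using that nxt_bij by (metis bij_betwE)
  have nxt_inv: "nxt G (inv_into (halfs G) (nxt G) h) = h" if "h \<in> halfs G" for h
    using that nxt_bij by (metis bij_betw_inv_into_right)
  have inv_nxt: "inv_into (halfs G) (nxt G) (nxt G h) = h" if "h \<in> halfs G" for h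
    using that nxt_bij by (metis bij_betw_inv_into_left)
  have UNIV_port: "UNIV = {Spoke, Fwd, Bwd}"
    using port.exhaust by blast
  show "ribbon_graph (blowup G)"
  proof
    show "finite (verts (blowup G))" "finite (halfs (blowup G))"
      using finite_halfs by (auto simp: blowup_def UNIV_port)
    show "bij_betw (nxt (blowup G)) (halfs (blowup G)) (halfs (blowup G))"
      by (rule bij_betw_byWitness[where f' = "nxt (blowup G) \<circ> nxt (blowup G)"])
         (auto simp: blowup_def split: port.split)
    fix x assume x: "x \<in> halfs (blowup G)"
    then obtain h p where hp: "x = (h, p)" "h \<in> halfs G"
      by (auto simp: blowup_def)
    show "base (blowup G) x \<in> verts (blowup G)" "base (blowup G) (nxt (blowup G) x) = base (blowup G) x"
      using hp by (auto simp: blowup_def)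
    show "opp (blowup G) x \<in> halfs (blowup G)" "opp (blowup G) x \<noteq> x"
      "opp (blowup G) (opp (blowup G) x) = x" "twist (blowup G) (opp (blowup G) x) = twist (blowup G) x"
      using hp
      by (cases p; simp add: blowup_def opp_in opp_neq opp_opp twist_opp nxt_in inv_in nxt_inv inv_nxt)+
    fix y assume "y \<in> halfs (blowup G)" "base (blowup G) x = base (blowup G) y"
    then obtain q where q: "y = (h, q)"
      using hp by (cases y) (auto simp: blowup_def)
    have "(nxt (blowup G) ^^ 0) x = y \<or> (nxt (blowup G) ^^ 1) x = y \<or> (nxt (blowup G) ^^ 2) x = y"
      using hp q by (cases p; cases q) (auto simp: blowup_def numeral_2_eq_2)
    then show "\<exists>i. (nxt (blowup G) ^^ i) x = y"
      by blast
  qed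
  have "card {x \<in> halfs (blowup G). base (blowup G) x = h} = 3" if "h \<in> halfs G" for h
  proof -
    have "{x \<in> halfs (blowup G). base (blowup G) x = h} = {(h, Spoke), (h, Fwd), (h, Bwd)}"
    proof (rule set_eqI)
      fix x :: "'h \<times> port"
      show "x \<in> {x \<in> halfs (blowup G). base (blowup G) x = h} \<longleftrightarrow> x \<in> {(h, Spoke), (h, Fwd), (h, Bwd)}"
        using that by (cases x; cases "snd x") (auto simp: blowup_def)
    qed
    then show ?thesis
      by simp
  qed
  moreover have "verts (blowup G) = halfs G"
    by (simp add: blowup_def)
  ultimately show "trivalent (blowup G)"
    unfolding trivalent_def by simp
  have "\<Union>(blowup_matching G) = halfs G \<times> {Spoke}"
    using opp_in by (auto simp: blowup_matching_def edge_of_def blowup_def)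
  moreover have "blowup_matching G \<subseteq> edges (blowup G)"
    by (auto simp: blowup_matching_def edges_def blowup_def)
  ultimately show "perfect_matching (blowup G) (blowup_matching G)"
    by (auto simp: perfect_matching_def) (auto simp: blowup_def)
qed

(* A vertex of degree 0 blows up to a circle without vertices, which has no half-edge in
   blowup G; the monomial factor accounts for these circles. *)

definition penrose :: "('v, 'h) rgraph \<Rightarrow> int poly" where
  "penrose G =
     monom 1 (card (verts G - base G ` halfs G)) * bracket (blowup G) (blowup_matching G)"


(* The arguments s1, ..., s4 are the half-edges of the spokes at the vertices v1, ..., v4 of the
   quadrilateral; c_i is the half-edge at v_i of the edge c_i from v_i to v_(i+1). *)

definition rotation3 :: "('v, 'h) rgraph \<Rightarrow> 'h \<Rightarrow> 'h \<Rightarrow> 'h \<Rightarrow> bool" where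
  "rotation3 G x y z \<longleftrightarrow> nxt G x = y \<and> nxt G y = z \<and> nxt G z = x"

definition quadrilateral_face :: "('v, 'h) rgraph \<Rightarrow> 'h \<Rightarrow> 'h \<Rightarrow> 'h \<Rightarrow> 'h \<Rightarrow> bool" where
  "quadrilateral_face G s1 s2 s3 s4 \<longleftrightarrow>
     {s1, s2, s3, s4} \<subseteq> halfs G \<and>
     distinct [base G s1, base G s2, base G s3, base G s4] \<and>
     (\<exists>c1 c2 c3 c4.
        rotation3 G s1 c1 (opp G c4) \<and>
        rotation3 G s2 c2 (opp G c1) \<and>
        rotation3 G s3 c3 (opp G c2) \<and>
        rotation3 G s4 c4 (opp G c3) \<and>
        \<not> twist G c1 \<and> \<not> twist G c2 \<and> \<not> twist G c3 \<and> \<not> twist G c4)"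

definition quad_verts :: "('v, 'h) rgraph \<Rightarrow> 'h \<Rightarrow> 'h \<Rightarrow> 'h \<Rightarrow> 'h \<Rightarrow> 'v set" where
  "quad_verts G s1 s2 s3 s4 = {base G s1, base G s2, base G s3, base G s4}"

definition outer_halfs :: "('v, 'h) rgraph \<Rightarrow> 'h \<Rightarrow> 'h \<Rightarrow> 'h \<Rightarrow> 'h \<Rightarrow> 'h set" where
  "outer_halfs G s1 s2 s3 s4 = {h \<in> halfs G. base G h \<notin> quad_verts G s1 s2 s3 s4}"

(* Two vertices joined by an untwisted edge with halves f and f', with clockwise orders (s1, s2, f)
   and (s3, s4, f'). The names of two of the removed vertices and of two of the removed half-edges
   (those of c1 and c3) serve as the names of the new ones. *)

definition replace_H :: "('v, 'h) rgraph \<Rightarrow> 'h \<Rightarrow> 'h \<Rightarrow> 'h \<Rightarrow> 'h \<Rightarrow> ('v, 'h) rgraph" where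
  "replace_H G s1 s2 s3 s4 =
     (let u = base G s1; w = base G s3; f = nxt G s1; f' = nxt G s3 in
      G\<lparr> verts := verts G - quad_verts G s1 s2 s3 s4 \<union> {u, w},
         halfs := outer_halfs G s1 s2 s3 s4 \<union> {s1, s2, s3, s4, f, f'},
         base := (base G)(s1 := u, s2 := u, f := u, s3 := w, s4 := w, f' := w),
         nxt := (nxt G)(s1 := s2, s2 := f, f := s1, s3 := s4, s4 := f', f' := s3),
         opp := (opp G)(f := f', f' := f),
         twist := (twist G)(f := False, f' := False) \<rparr>)"

(* Clockwise orders (s2, s3, f) and (s4, s1, f'): the configuration H turned by a quarter. *)

definition replace_I :: "('v, 'h) rgraph \<Rightarrow> 'h \<Rightarrow> 'h \<Rightarrow> 'h \<Rightarrow> 'h \<Rightarrow> ('v, 'h) rgraph" where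
  "replace_I G s1 s2 s3 s4 = replace_H G s2 s3 s4 s1"

definition replace_vertex :: "('v, 'h) rgraph \<Rightarrow> 'h \<Rightarrow> 'h \<Rightarrow> 'h \<Rightarrow> 'h \<Rightarrow> ('v, 'h) rgraph" where
  "replace_vertex G s1 s2 s3 s4 =
     (let u = base G s1 in
      G\<lparr> verts := verts G - quad_verts G s1 s2 s3 s4 \<union> {u},
         halfs := outer_halfs G s1 s2 s3 s4 \<union> {s1, s2, s3, s4},
         base := (base G)(s1 := u, s2 := u, s3 := u, s4 := u),
         nxt := (nxt G)(s1 := s2, s2 := s3, s3 := s4, s4 := s1) \<rparr>)"

(* Spoke a is joined to b and c to d. The halves of the spokes at the quadrilateral disappear, and
   the far halves opp a, opp b (resp. opp c, opp d) become the two halves of one edge. *)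

definition join_spokes :: "('v, 'h) rgraph \<Rightarrow> 'h \<Rightarrow> 'h \<Rightarrow> 'h \<Rightarrow> 'h \<Rightarrow> ('v, 'h) rgraph" where
  "join_spokes G a b c d =
     (let a' = opp G a; b' = opp G b; c' = opp G c; d' = opp G d;
          tab = (twist G a \<noteq> twist G b); tcd = (twist G c \<noteq> twist G d) in
      G\<lparr> verts := verts G - quad_verts G a b c d,
         halfs := outer_halfs G a b c d,
         opp := (opp G)(a' := b', b' := a', c' := d', d' := c'),
         twist := (twist G)(a' := tab, b' := tab, c' := tcd, d' := tcd) \<rparr>)"

definition replace_par :: "('v, 'h) rgraph \<Rightarrow> 'h \<Rightarrow> 'h \<Rightarrow> 'h \<Rightarrow> 'h \<Rightarrow> ('v, 'h) rgraph" where
  "replace_par G s1 s2 s3 s4 = join_spokes G s1 s4 s2 s3"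

definition replace_eq :: "('v, 'h) rgraph \<Rightarrow> 'h \<Rightarrow> 'h \<Rightarrow> 'h \<Rightarrow> 'h \<Rightarrow> ('v, 'h) rgraph" where
  "replace_eq G s1 s2 s3 s4 = join_spokes G s1 s2 s3 s4"

definition replace_cross :: "('v, 'h) rgraph \<Rightarrow> 'h \<Rightarrow> 'h \<Rightarrow> 'h \<Rightarrow> 'h \<Rightarrow> ('v, 'h) rgraph" where
  "replace_cross G s1 s2 s3 s4 = join_spokes G s1 s3 s2 s4"

end

(* For a positive integer n, a state contributes n to the number of circles, that is, the number of
   colourings of the corners of the vertex discs by n colours that are constant along the circles.
   Summing over the states first turns the polynomial at n into a sum over all colourings of a product
   of edge weights +-(parallel - crossed), each antisymmetric in the two corners at either end of the
   edge. Fixing the colours outside the disc, every configuration becomes a multilinear form in four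
   antisymmetric n x n matrices w1, ..., w4 coming from the spokes. With tau(ijkl) = tr(wi wj wk wl)
   and <ij> the entrywise pairing, the square gives
     (n - 4) tau(1234) - 2 tau(1342) - 2 tau(1324) + <12><34> + <14><23> + <13><24>,
   while H gives tau(1234) - tau(1342), I gives tau(1234) - tau(1324), the 4-valent vertex gives
   tau(1234), and joining spokes i, j and k, l gives <ij><kl> / 4. At n = 4 these forms satisfy the
   identity. *)

theory Submission
  imports Defs "HOL-Library.FuncSet" "HOL-Library.Cardinality"
begin

section \<open>State sum over colourings\<close>

text \<open>Exchanging the two corners at one end of a ribbon turns the untwisted joins into the
  half-twisted ones, so an edge weight, being the difference of the two, changes sign. This
  antisymmetry does most of the work: a trace of four such matrices is unchanged by rotating and by
  reversing the word, so the 24 words in four letters give only three traces, and every term that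
  evaluates a matrix on its diagonal drops out. The obstacle is that the seven graphs have different
  half-edges, hence different sets of colourings. They share the half-edges outside the disc
  together with \<open>nxt\<close> there, so each state sum splits into one common outer sum with
  one common weight and an inner sum that sees the outside only through the matrices of the spokes.
  Distinct spoke edges ensure that the far end of every spoke lies outside, so that each matrix is
  fixed once the outer colours are.\<close>

lemma card_colourings_quotient:
  fixes J :: "'a rel"
  assumes fin: "finite S" and J: "J \<subseteq> S \<times> S"
  shows "card {f \<in> S \<rightarrow>\<^sub>E (UNIV :: 'c::finite set). \<forall>(a, b) \<in> J. f a = f b} =
    CARD('c) ^ card (S // (J \<union> J\<inverse>)\<^sup>*)"
proof -
  define R where "R = (J \<union> J\<inverse>)\<^sup>*"
  have eq: "equiv UNIV R"
    unfolding R_def by (intro equivI) (auto simp: refl_rtrancl sym_rtrancl sym_Un_converse trans_rtrancl)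
  \<comment> \<open>The closure is taken over the whole type; since \<open>J\<close> lives on
    \<open>S\<close>, it never leads out of \<open>S\<close>.\<close>
  have R_in: "y \<in> S" if "(x, y) \<in> R" "x \<in> S" for x y
    using that unfolding R_def by (induction rule: rtrancl_induct) (use J in auto)
  have R_const: "f x = f y" if "(x, y) \<in> R" "\<forall>(a, b) \<in> J. f a = f b" for x y and f :: "'a \<Rightarrow> 'c"
    using that unfolding R_def by (induction rule: rtrancl_induct) auto
  have refl_R: "(x, x) \<in> R" for x
    by (simp add: R_def)
  have rep: "(x, SOME y. (x, y) \<in> R) \<in> R" for x
    by (rule someI[of "\<lambda>y. (x, y) \<in> R", OF refl_R])
  have cls: "R `` {x} = R `` {y}" if "(x, y) \<in> R" for x y
    using equiv_class_eq[OF eq that] .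
  \<comment> \<open>A colouring constant along \<open>J\<close> is a choice of one colour per class;
    the inverse reads the colour off at an arbitrary representative.\<close>
  have "bij_betw (\<lambda>g. \<lambda>x\<in>S. g (R `` {x})) (S // R \<rightarrow>\<^sub>E (UNIV :: 'c set))
     {f \<in> S \<rightarrow>\<^sub>E (UNIV :: 'c set). \<forall>(a, b) \<in> J. f a = f b}"
  proof (rule bij_betw_byWitness[where f' = "\<lambda>f. \<lambda>X\<in>S // R. f (SOME y. y \<in> X)"])
    show "\<forall>g\<in>S // R \<rightarrow>\<^sub>E (UNIV :: 'c set).
        (\<lambda>X\<in>S // R. (\<lambda>x\<in>S. g (R `` {x})) (SOME y. y \<in> X)) = g"
    proof (intro ballI ext)
      fix g :: "'a set \<Rightarrow> 'c" and X assume g: "g \<in> S // R \<rightarrow>\<^sub>E UNIV"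
      show "(\<lambda>X\<in>S // R. (\<lambda>x\<in>S. g (R `` {x})) (SOME y. y \<in> X)) X = g X"
      proof (cases "X \<in> S // R")
        case True
        then obtain x where x: "x \<in> S" "X = R `` {x}"
          by (auto elim: quotientE)
        then have "(SOME y. y \<in> X) = (SOME y. (x, y) \<in> R)"
          by simp
        moreover have "R `` {SOME y. (x, y) \<in> R} = X"
          using x cls[OF rep[of x]] by simp
        ultimately show ?thesis
          using True R_in[OF rep x(1)] by simp
      qed (use g in \<open>auto simp: PiE_def extensional_def\<close>)
    qed
    show "\<forall>f\<in>{f \<in> S \<rightarrow>\<^sub>E (UNIV :: 'c set). \<forall>(a, b) \<in> J. f a = f b}.
        (\<lambda>x\<in>S. (\<lambda>X\<in>S // R. f (SOME y. y \<in> X)) (R `` {x})) = f"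
    proof (intro ballI ext)
      fix f :: "'a \<Rightarrow> 'c" and x
      assume f: "f \<in> {f \<in> S \<rightarrow>\<^sub>E (UNIV :: 'c set). \<forall>(a, b) \<in> J. f a = f b}"
      then have "f x = f (SOME y. (x, y) \<in> R)"
        by (intro R_const rep) auto
      then show "(\<lambda>x\<in>S. (\<lambda>X\<in>S // R. f (SOME y. y \<in> X)) (R `` {x})) x = f x"
        using f by (auto simp: quotientI PiE_def extensional_def)
    qed
    show "(\<lambda>g. \<lambda>x\<in>S. g (R `` {x})) ` (S // R \<rightarrow>\<^sub>E (UNIV :: 'c set)) \<subseteq>
        {f \<in> S \<rightarrow>\<^sub>E (UNIV :: 'c set). \<forall>(a, b) \<in> J. f a = f b}"
    proof safe
      fix g :: "'a set \<Rightarrow> 'c" and a b assume ab: "(a, b) \<in> J"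
      then have "a \<in> S" "b \<in> S" "(a, b) \<in> R"
        using J by (auto simp: R_def)
      then show "(\<lambda>x\<in>S. g (R `` {x})) a = (\<lambda>x\<in>S. g (R `` {x})) b"
        by (simp add: cls)
    qed auto
    show "(\<lambda>f. \<lambda>X\<in>S // R. f (SOME y. y \<in> X)) `
        {f \<in> S \<rightarrow>\<^sub>E (UNIV :: 'c set). \<forall>(a, b) \<in> J. f a = f b} \<subseteq> S // R \<rightarrow>\<^sub>E (UNIV :: 'c set)"
      by auto
  qed
  then have "card {f \<in> S \<rightarrow>\<^sub>E (UNIV :: 'c set). \<forall>(a, b) \<in> J. f a = f b} =
      card (S // R \<rightarrow>\<^sub>E (UNIV :: 'c set))"
    by (simp add: bij_betw_same_card)
  moreover have "finite (S // R)"
    by (simp add: quotient_def fin)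
  ultimately show ?thesis
    by (simp add: card_funcsetE R_def)
qed

text \<open>The axioms on which the state sum rests. The graphs after a replacement enter through
  this locale, so for them only the half-edges, \<open>nxt\<close>, \<open>opp\<close> and
  \<open>twist\<close> have to be examined.\<close>

locale half_edge_system =
  fixes G :: "('v, 'h) rgraph"
  assumes finite_halfs: "finite (halfs G)"
    and nxt_bij: "bij_betw (nxt G) (halfs G) (halfs G)"
    and opp_in: "h \<in> halfs G \<Longrightarrow> opp G h \<in> halfs G"
    and opp_opp: "h \<in> halfs G \<Longrightarrow> opp G (opp G h) = h"
    and twist_opp: "h \<in> halfs G \<Longrightarrow> twist G (opp G h) = twist G h"

sublocale ribbon_graph \<subseteq> half_edge_system
  using finite_halfs nxt_bij opp_in opp_opp twist_opp by unfold_locales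

definition prev_half :: "('v, 'h) rgraph \<Rightarrow> 'h \<Rightarrow> 'h" where
  "prev_half G h = inv_into (halfs G) (nxt G) h"

text \<open>A colouring \<open>x\<close> of the half-edges colours the corner between \<open>h\<close> and \<open>nxt G h\<close> by \<open>x h\<close>.
  Thus an edge with halves \<open>h\<close> and \<open>h'\<close> sees \<open>a = x h\<close> and \<open>b = x (prev_half G h)\<close> at one end, and
  \<open>a'\<close>, \<open>b'\<close> at the other.\<close>

definition joined :: "bool \<Rightarrow> 'c \<Rightarrow> 'c \<Rightarrow> 'c \<Rightarrow> 'c \<Rightarrow> bool" where
  "joined t a b a' b' \<longleftrightarrow> (if t then a = a' \<and> b = b' else a = b' \<and> b = a')"

definition strand :: "bool \<Rightarrow> 'c \<Rightarrow> 'c \<Rightarrow> 'c \<Rightarrow> 'c \<Rightarrow> int" where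
  "strand t a b a' b' = of_bool (joined t a b a' b') - of_bool (joined (\<not> t) a b a' b')"

definition strand_at :: "('v, 'h) rgraph \<Rightarrow> ('h \<Rightarrow> 'c) \<Rightarrow> 'h \<Rightarrow> int" where
  "strand_at G x h =
    strand (twist G h) (x h) (x (prev_half G h)) (x (opp G h)) (x (prev_half G (opp G h)))"

text \<open>One half from each edge. Subsets of \<open>T\<close> then index the states, and a
  product over \<open>T\<close> has one factor per edge.\<close>

definition transversal :: "('v, 'h) rgraph \<Rightarrow> 'h set \<Rightarrow> bool" where
  "transversal G T \<longleftrightarrow> T \<subseteq> halfs G \<and> (\<forall>h \<in> halfs G. opp G h \<in> T \<longleftrightarrow> h \<notin> T)"

section \<open>Corner colourings and the circles of the blowup\<close>

context half_edge_system
begin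

lemma nxt_in: "h \<in> halfs G \<Longrightarrow> nxt G h \<in> halfs G"
  using nxt_bij by (metis bij_betwE)

lemma prev_in: "h \<in> halfs G \<Longrightarrow> prev_half G h \<in> halfs G"
  unfolding prev_half_def using nxt_bij by (metis bij_betw_imp_surj_on inv_into_into)

lemma nxt_prev: "h \<in> halfs G \<Longrightarrow> nxt G (prev_half G h) = h"
  unfolding prev_half_def using nxt_bij by (metis bij_betw_inv_into_right)

lemma prev_nxt: "h \<in> halfs G \<Longrightarrow> prev_half G (nxt G h) = h"
  unfolding prev_half_def using nxt_bij by (metis bij_betw_inv_into_left)

lemma Union_blowup_matching: "\<Union>(blowup_matching G) = halfs G \<times> {Spoke}"
  using opp_in by (auto simp: blowup_matching_def edge_of_def blowup_def)

lemma blowup_halfs_minus_spokes: "halfs (blowup G) - halfs G \<times> {Spoke} = halfs G \<times> {Fwd, Bwd}"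
proof -
  have "(UNIV :: port set) = {Spoke, Fwd, Bwd}"
    using port.exhaust by blast
  then show ?thesis
    by (auto simp: blowup_def)
qed

definition spokes :: "'h set \<Rightarrow> ('h \<times> port) set set" where
  "spokes B = (\<lambda>h. edge_of (blowup G) (h, Spoke)) ` B"

lemma spoke_in_spokes:
  assumes "transversal G T" "B \<subseteq> T" "h \<in> T"
  shows "edge_of (blowup G) (h, Spoke) \<in> spokes B \<longleftrightarrow> h \<in> B"
    "edge_of (blowup G) (opp G h, Spoke) \<in> spokes B \<longleftrightarrow> h \<in> B"
proof -
  have "h \<in> halfs G" "opp G h \<notin> B" "opp G (opp G h) = h"
    using assms opp_opp by (auto simp: transversal_def)
  moreover have "B \<subseteq> halfs G" "\<And>k. k \<in> B \<Longrightarrow> opp G k \<notin> T"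
    using assms by (auto simp: transversal_def)
  ultimately show "edge_of (blowup G) (h, Spoke) \<in> spokes B \<longleftrightarrow> h \<in> B"
    "edge_of (blowup G) (opp G h, Spoke) \<in> spokes B \<longleftrightarrow> h \<in> B"
    using assms
    by (auto simp: spokes_def edge_of_def blowup_def doubleton_eq_iff image_iff)
qed

lemma inj_on_spokes:
  assumes "transversal G T"
  shows "inj_on (\<lambda>h. edge_of (blowup G) (h, Spoke)) T"
  using assms by (auto simp: inj_on_def edge_of_def blowup_def doubleton_eq_iff transversal_def)

lemma blowup_matching_transversal:
  assumes "transversal G T"
  shows "blowup_matching G = spokes T"
proof -
  have "edge_of (blowup G) (h, Spoke) \<in> spokes T" if "h \<in> halfs G" for h
  proof (cases "h \<in> T")
    case False
    then have "opp G h \<in> T" "opp G (opp G h) = h"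
      using assms that opp_opp by (auto simp: transversal_def)
    then show ?thesis
      using spoke_in_spokes(2)[OF assms order_refl, of "opp G h"] by simp
  qed (simp add: spokes_def)
  then show ?thesis
    using assms by (auto simp: blowup_matching_def spokes_def transversal_def)
qed

definition state_joined :: "'h set \<Rightarrow> ('h \<Rightarrow> 'c) \<Rightarrow> 'h \<Rightarrow> bool" where
  "state_joined B x h = joined (twist G h \<noteq> (h \<in> B))
    (x h) (x (prev_half G h)) (x (opp G h)) (x (prev_half G (opp G h)))"

text \<open>The \<open>Fwd\<close> port of \<open>h\<close> carries the corner after
  \<open>h\<close> and the \<open>Bwd\<close> port the corner before it, so the two ends of each
  edge of a vertex circle agree in colour.\<close>

definition corner_colouring :: "('h \<Rightarrow> 'c) \<Rightarrow> 'h \<times> port \<Rightarrow> 'c" where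
  "corner_colouring x =
    (\<lambda>(h, p) \<in> halfs G \<times> {Fwd, Bwd}. if p = Fwd then x h else x (prev_half G h))"

text \<open>Constancy along the vertex circles determines the \<open>Bwd\<close> colours from the
  \<open>Fwd\<close> colours, which leaves one colour per corner; the joins at the matching edges
  become \<open>state_joined\<close>.\<close>

lemma bij_betw_corner_colouring:
  assumes T: "transversal G T" and B: "B \<subseteq> T"
  shows "bij_betw corner_colouring
    {x \<in> halfs G \<rightarrow>\<^sub>E (UNIV :: 'c set). \<forall>h \<in> T. state_joined B x h}
    {f \<in> halfs G \<times> {Fwd, Bwd} \<rightarrow>\<^sub>E (UNIV :: 'c set).
      \<forall>(a, b) \<in> smoothing_joins (blowup G) (blowup_matching G) (spokes B). f a = f b}"
    (is "bij_betw _ ?X {f \<in> ?F. \<forall>(a, b) \<in> ?J. f a = f b}")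
proof -
  have T_halfs: "T \<subseteq> halfs G" and T_opp: "\<And>h. h \<in> halfs G \<Longrightarrow> opp G h \<in> T \<longleftrightarrow> h \<notin> T"
    using T by (auto simp: transversal_def)
  \<comment> \<open>The joins are listed from both halves of every edge. Since \<open>joined\<close>
    is symmetric under exchanging the two ends, the halves in \<open>T\<close> suffice.\<close>
  have side: "(\<forall>h \<in> T. state_joined B x h) \<longleftrightarrow>
      (\<forall>h \<in> halfs G. joined (twist G h \<noteq> (edge_of (blowup G) (h, Spoke) \<in> spokes B))
        (x h) (x (prev_half G h)) (x (opp G h)) (x (prev_half G (opp G h))))"
    (is "_ \<longleftrightarrow> (\<forall>h \<in> halfs G. ?P h)") for x :: "'h \<Rightarrow> 'c"
  proof -
    have 1: "?P h \<longleftrightarrow> state_joined B x h" if "h \<in> T" for h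
      using spoke_in_spokes(1)[OF T B that] by (simp add: state_joined_def)
    have 2: "?P (opp G h) \<longleftrightarrow> state_joined B x h" if "h \<in> T" for h
      using spoke_in_spokes(2)[OF T B that] that T_halfs opp_opp[of h] twist_opp[of h]
      by (auto simp: state_joined_def joined_def)
    have "?P h" if "\<forall>h \<in> T. state_joined B x h" "h \<in> halfs G" for h
    proof (cases "h \<in> T")
      case False
      then show ?thesis
        using 2[of "opp G h"] that T_opp opp_opp by simp
    qed (use that 1 in auto)
    then show ?thesis
      using 1 T_halfs by blast
  qed
  have J: "(\<forall>(a, b) \<in> ?J. f a = f b) \<longleftrightarrow>
      (\<forall>h \<in> halfs G. f (h, Fwd) = f (nxt G h, Bwd)) \<and> (\<forall>h \<in> halfs G. f (h, Bwd) = f (prev_half G h, Fwd)) \<and>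
      (\<forall>h \<in> halfs G. joined (twist G h \<noteq> (edge_of (blowup G) (h, Spoke) \<in> spokes B))
        (f (h, Fwd)) (f (h, Bwd)) (f (opp G h, Fwd)) (f (opp G h, Bwd)))"
    for f :: "'h \<times> port \<Rightarrow> 'c"
  proof -
    have e: "?J = {((h, Fwd), (nxt G h, Bwd)) | h. h \<in> halfs G} \<union>
        {((h, Bwd), (prev_half G h, Fwd)) | h. h \<in> halfs G} \<union>
        (\<Union>h \<in> halfs G. if twist G h \<noteq> (edge_of (blowup G) (h, Spoke) \<in> spokes B)
           then {((h, Fwd), (opp G h, Fwd)), ((h, Bwd), (opp G h, Bwd))}
           else {((h, Fwd), (opp G h, Bwd)), ((h, Bwd), (opp G h, Fwd))})"
    proof -
      have 1: "{(h, opp (blowup G) h) |h. h \<in> halfs G \<times> {Fwd, Bwd}} =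
         {((h, Fwd), (nxt G h, Bwd)) | h. h \<in> halfs G} \<union>
         {((h, Bwd), (prev_half G h, Fwd)) | h. h \<in> halfs G}"
        by (force simp: blowup_def prev_half_def)
      have 2: "(\<Union>m \<in> halfs G \<times> {Spoke}. F m) = (\<Union>h \<in> halfs G. F (h, Spoke))" for F :: "_ \<Rightarrow> ('h \<times> port) rel"
        by auto
      have 3: "nxt (blowup G) (h, Spoke) = (h, Fwd)" "nxt (blowup G) (h, Fwd) = (h, Bwd)"
          "opp (blowup G) (h, Spoke) = (opp G h, Spoke)" "twist (blowup G) (h, Spoke) = twist G h" for h
        by (simp_all add: blowup_def)
      show ?thesis
        unfolding smoothing_joins_def Union_blowup_matching blowup_halfs_minus_spokes 1 2
        by (simp only: Let_def 3)
    qed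
    show ?thesis
      unfolding e by (fastforce simp: joined_def split: if_splits)
  qed
  show ?thesis
  proof (rule bij_betw_byWitness[where f' = "\<lambda>f. \<lambda>h\<in>halfs G. f (h, Fwd)"])
    show "\<forall>x\<in>?X. (\<lambda>h\<in>halfs G. corner_colouring x (h, Fwd)) = x"
      by (auto simp: corner_colouring_def fun_eq_iff PiE_def extensional_def)
    show "\<forall>f\<in>{f \<in> ?F. \<forall>(a, b) \<in> ?J. f a = f b}. corner_colouring (\<lambda>h\<in>halfs G. f (h, Fwd)) = f"
      unfolding J
      by (auto simp: corner_colouring_def fun_eq_iff PiE_def extensional_def prev_in)
    show "corner_colouring ` ?X \<subseteq> {f \<in> ?F. \<forall>(a, b) \<in> ?J. f a = f b}"
    proof (intro image_subsetI CollectI conjI)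
      fix x assume x: "x \<in> ?X"
      show "corner_colouring x \<in> ?F"
        by (simp add: corner_colouring_def PiE_def)
      show "\<forall>(a, b) \<in> ?J. corner_colouring x a = corner_colouring x b"
        using x unfolding J side by (simp add: corner_colouring_def nxt_in prev_in opp_in prev_nxt)
    qed
    show "(\<lambda>f. \<lambda>h\<in>halfs G. f (h, Fwd)) ` {f \<in> ?F. \<forall>(a, b) \<in> ?J. f a = f b} \<subseteq> ?X"
      unfolding J side by (auto simp: prev_in opp_in)
  qed
qed

lemma power_circles:
  assumes T: "transversal G T" and B: "B \<subseteq> T"
  shows "int CARD('c::finite) ^ circles (blowup G) (blowup_matching G) (spokes B) =
    (\<Sum>x \<in> halfs G \<rightarrow>\<^sub>E (UNIV :: 'c set). \<Prod>h \<in> T. of_bool (state_joined B x h))"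
proof -
  let ?J = "smoothing_joins (blowup G) (blowup_matching G) (spokes B)"
  have fin: "finite (halfs G \<rightarrow>\<^sub>E (UNIV :: 'c set))" "finite T"
    using finite_halfs T finite_subset by (auto intro!: finite_PiE simp: transversal_def)
  have port: "p = Spoke \<or> p = Fwd \<or> p = Bwd" for p
    by (cases p) auto
  have "?J \<subseteq> (halfs G \<times> {Fwd, Bwd}) \<times> (halfs G \<times> {Fwd, Bwd})"
    unfolding smoothing_joins_def Union_blowup_matching blowup_halfs_minus_spokes
    using port by (auto simp: blowup_def Let_def nxt_in opp_in prev_in prev_half_def[symmetric]
        split: port.splits)
  then have "int CARD('c) ^ circles (blowup G) (blowup_matching G) (spokes B) =
      int (card {f \<in> halfs G \<times> {Fwd, Bwd} \<rightarrow>\<^sub>E (UNIV :: 'c set). \<forall>(a, b) \<in> ?J. f a = f b})"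
    by (subst card_colourings_quotient)
       (auto simp: circles_def Let_def Union_blowup_matching blowup_halfs_minus_spokes finite_halfs)
  also have "\<dots> = int (card {x \<in> halfs G \<rightarrow>\<^sub>E (UNIV :: 'c set). \<forall>h \<in> T. state_joined B x h})"
    by (simp only: bij_betw_same_card[OF bij_betw_corner_colouring[OF assms]])
  also have "\<dots> = (\<Sum>x \<in> halfs G \<rightarrow>\<^sub>E (UNIV :: 'c set). of_bool (\<forall>h \<in> T. state_joined B x h))"
    using fin by (simp add: of_bool_def sum.If_cases Int_def)
  also have "\<dots> = (\<Sum>x \<in> halfs G \<rightarrow>\<^sub>E (UNIV :: 'c set). \<Prod>h \<in> T. of_bool (state_joined B x h))"
  proof (intro sum.cong refl)
    show "of_bool (\<forall>h \<in> T. state_joined B x h) = (\<Prod>h \<in> T. of_bool (state_joined B x h) :: int)"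
      for x :: "'h \<Rightarrow> 'c"
      using fin(2) by (induction T rule: finite_induct) auto
  qed
  finally show ?thesis .
qed

theorem penrose_state_sum:
  assumes T: "transversal G T" and no_isolated: "verts G \<subseteq> base G ` halfs G"
  shows "poly (penrose G) (int CARD('c::finite)) =
    (\<Sum>x \<in> halfs G \<rightarrow>\<^sub>E (UNIV :: 'c set). \<Prod>h \<in> T. strand_at G x h)"
proof -
  let ?n = "int CARD('c)" and ?X = "halfs G \<rightarrow>\<^sub>E (UNIV :: 'c set)"
  have finT: "finite T"
    using finite_halfs T finite_subset by (auto simp: transversal_def)
  \<comment> \<open>This makes the monomial factor in \<open>penrose\<close> equal to 1.\<close>
  have isolated: "verts G - base G ` halfs G = {}"
    using no_isolated by blast
  have "poly (penrose G) ?n =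
      (\<Sum>A \<in> Pow (spokes T). (-1) ^ card A * ?n ^ circles (blowup G) (blowup_matching G) A)"
    using blowup_matching_transversal[OF T]
    unfolding penrose_def bracket_def isolated by (simp add: poly_sum poly_monom)
  also have "Pow (spokes T) = spokes ` Pow T"
    unfolding spokes_def by (rule image_Pow_surj[symmetric]) simp
  also have "(\<Sum>A \<in> spokes ` Pow T. (-1) ^ card A * ?n ^ circles (blowup G) (blowup_matching G) A) =
      (\<Sum>B \<in> Pow T. (-1) ^ card B * ?n ^ circles (blowup G) (blowup_matching G) (spokes B))"
  proof (subst sum.reindex)
    show "inj_on spokes (Pow T)"
      unfolding spokes_def using inj_on_image_Pow[OF inj_on_spokes[OF T]] .
    have "card (spokes B) = card B" if "B \<subseteq> T" for B
      unfolding spokes_def using inj_on_subset[OF inj_on_spokes[OF T] that] by (rule card_image)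
    then show "sum ((\<lambda>A. (-1) ^ card A * ?n ^ circles (blowup G) (blowup_matching G) A) \<circ> spokes) (Pow T) =
        (\<Sum>B \<in> Pow T. (-1) ^ card B * ?n ^ circles (blowup G) (blowup_matching G) (spokes B))"
      by (intro sum.cong) auto
  qed
  also have "\<dots> = (\<Sum>B \<in> Pow T. \<Sum>x \<in> ?X. (-1) ^ card B * (\<Prod>h \<in> T. of_bool (state_joined B x h)))"
    by (intro sum.cong) (simp_all add: power_circles[OF T] sum_distrib_left)
  also have "\<dots> = (\<Sum>x \<in> ?X. \<Sum>B \<in> Pow T. (-1) ^ card B * (\<Prod>h \<in> T. of_bool (state_joined B x h)))"
    by (rule sum.swap)
  also have "\<dots> = (\<Sum>x \<in> ?X. \<Prod>h \<in> T. strand_at G x h)"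
  proof (intro sum.cong refl)
    fix x :: "'h \<Rightarrow> 'c"
    \<comment> \<open>For a fixed colouring the edges decouple: \<open>B\<close> selects the
      1-smoothed term at its members, and the signed sum over all \<open>B\<close> is the expansion
      of a product of differences.\<close>
    let ?f = "\<lambda>t h. of_bool (joined (twist G h \<noteq> t)
        (x h) (x (prev_half G h)) (x (opp G h)) (x (prev_half G (opp G h)))) :: int"
    have "(\<Prod>h \<in> T. of_bool (state_joined B x h) :: int) = (\<Prod>h \<in> B. ?f True h) * (\<Prod>h \<in> T - B. ?f False h)"
      if "B \<subseteq> T" for B
    proof -
      have "(\<Prod>h \<in> T. of_bool (state_joined B x h) :: int) =
          (\<Prod>h \<in> T - B. of_bool (state_joined B x h)) * (\<Prod>h \<in> B. of_bool (state_joined B x h))"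
        by (rule prod.subset_diff[OF that finT])
      then show ?thesis
        by (simp add: state_joined_def mult.commute)
    qed
    moreover have "(\<Prod>h \<in> T. strand_at G x h) = (\<Prod>h \<in> T. ?f False h - ?f True h)"
      by (intro prod.cong) (auto simp: strand_at_def strand_def)
    ultimately show "(\<Sum>B \<in> Pow T. (-1) ^ card B * (\<Prod>h \<in> T. of_bool (state_joined B x h))) =
        (\<Prod>h \<in> T. strand_at G x h)"
      using finT by (simp add: prod_diff_conv_sum mult.assoc)
  qed
  finally show ?thesis .
qed

end

section \<open>The trace identity\<close>

definition compose :: "('c::finite \<Rightarrow> 'c \<Rightarrow> int) \<Rightarrow> ('c \<Rightarrow> 'c \<Rightarrow> int) \<Rightarrow> 'c \<Rightarrow> 'c \<Rightarrow> int" where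
  "compose A B a b = (\<Sum>k\<in>UNIV. A a k * B k b)"

definition tr :: "('c::finite \<Rightarrow> 'c \<Rightarrow> int) \<Rightarrow> int" where
  "tr A = (\<Sum>a\<in>UNIV. A a a)"

definition antisym_fun :: "('c \<Rightarrow> 'c \<Rightarrow> int) \<Rightarrow> bool" where
  "antisym_fun w \<longleftrightarrow> (\<forall>a b. w a b = - w b a)"

lemma compose_assoc: "compose (compose A B) C = compose A (compose B C)"
  unfolding compose_def sum_distrib_left sum_distrib_right
  by (intro ext, subst sum.swap) (simp add: mult.assoc)

lemma tr_compose_commute: "tr (compose A B) = tr (compose B A)"
  unfolding tr_def compose_def by (subst sum.swap) (simp add: mult.commute)

lemma tr_compose2:
  "tr (compose A B) = (\<Sum>a\<in>UNIV. \<Sum>b\<in>UNIV. A a b * B b a)"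
  by (simp add: tr_def compose_def)

lemma tr_compose4:
  "tr (compose A (compose B (compose C D))) =
    (\<Sum>a\<in>UNIV. \<Sum>b\<in>UNIV. \<Sum>c\<in>UNIV. \<Sum>d\<in>UNIV. A a b * B b c * C c d * D d a)"
  by (simp add: tr_def compose_def sum_distrib_left mult.assoc)

lemma tr_rotate4:
  "tr (compose A (compose B (compose C D))) = tr (compose B (compose C (compose D A)))"
  by (subst tr_compose_commute) (simp add: compose_assoc)

text \<open>Transposition reverses the order, and the four signs cancel.\<close>

lemma tr_reverse4:
  assumes "antisym_fun A" "antisym_fun B" "antisym_fun C" "antisym_fun D"
  shows "tr (compose A (compose B (compose C D))) = tr (compose D (compose C (compose B A)))"
proof -
  have "tr (compose A (compose B (compose C D))) =
      (\<Sum>a\<in>UNIV. \<Sum>b\<in>UNIV. \<Sum>c\<in>UNIV. \<Sum>d\<in>UNIV. D a d * C d c * B c b * A b a)"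
    unfolding tr_compose4
  proof (intro sum.cong refl)
    fix a b c d
    have "A a b = - A b a" "B b c = - B c b" "C c d = - C d c" "D d a = - D a d"
      using assms unfolding antisym_fun_def by blast+
    then show "A a b * B b c * C c d * D d a = D a d * C d c * B c b * A b a"
      by simp
  qed
  also have "\<dots> = (\<Sum>a\<in>UNIV. \<Sum>d\<in>UNIV. \<Sum>c\<in>UNIV. \<Sum>b\<in>UNIV. D a d * C d c * B c b * A b a)"
  proof (rule sum.cong[OF refl])
    fix a
    let ?F = "\<lambda>b c d. D a d * C d c * B c b * A b a"
    have "(\<Sum>b\<in>UNIV. \<Sum>c\<in>UNIV. \<Sum>d\<in>UNIV. ?F b c d) = (\<Sum>b\<in>UNIV. \<Sum>d\<in>UNIV. \<Sum>c\<in>UNIV. ?F b c d)"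
      by (intro sum.cong refl sum.swap)
    also have "\<dots> = (\<Sum>d\<in>UNIV. \<Sum>b\<in>UNIV. \<Sum>c\<in>UNIV. ?F b c d)"
      by (rule sum.swap)
    also have "\<dots> = (\<Sum>d\<in>UNIV. \<Sum>c\<in>UNIV. \<Sum>b\<in>UNIV. ?F b c d)"
      by (intro sum.cong refl sum.swap)
    finally show "(\<Sum>b\<in>UNIV. \<Sum>c\<in>UNIV. \<Sum>d\<in>UNIV. ?F b c d) = (\<Sum>d\<in>UNIV. \<Sum>c\<in>UNIV. \<Sum>b\<in>UNIV. ?F b c d)" .
  qed
  finally show ?thesis
    by (simp add: tr_compose4)
qed

section \<open>Fourfold sums and contraction of Kronecker deltas\<close>

definition sum4 :: "('c::finite \<Rightarrow> 'c \<Rightarrow> 'c \<Rightarrow> 'c \<Rightarrow> int) \<Rightarrow> int" where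
  "sum4 F = (\<Sum>a\<in>UNIV. \<Sum>b\<in>UNIV. \<Sum>c\<in>UNIV. \<Sum>d\<in>UNIV. F a b c d)"

lemma sum4_add: "sum4 (\<lambda>a b c d. F a b c d + G a b c d) = sum4 F + sum4 G"
  by (simp add: sum4_def sum.distrib)

lemma sum4_diff: "sum4 (\<lambda>a b c d. F a b c d - G a b c d) = sum4 F - sum4 G"
  by (simp add: sum4_def sum_subtractf)

lemma sum4_swap12: "sum4 (\<lambda>a b c d. F b a c d) = sum4 F"
  unfolding sum4_def by (rule sum.swap)

lemma sum4_swap23: "sum4 (\<lambda>a b c d. F a c b d) = sum4 F"
  unfolding sum4_def by (intro sum.cong refl sum.swap)

lemma sum4_swap34: "sum4 (\<lambda>a b c d. F a b d c) = sum4 F"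
  unfolding sum4_def by (intro sum.cong refl sum.swap)

lemma sum4_tr: "sum4 (\<lambda>a b c d. A a b * B b c * C c d * D d a) = tr (compose A (compose B (compose C D)))"
  by (simp add: sum4_def tr_compose4)

lemma tr_compose3:
  "tr (compose A (compose B C)) = (\<Sum>a\<in>UNIV. \<Sum>b\<in>UNIV. \<Sum>c\<in>UNIV. A a b * B b c * C c a)"
  by (simp add: tr_def compose_def sum_distrib_left mult.assoc)

text \<open>The delta has to be the leftmost factor; the rearrangements of summands below serve to
  reach this shape.\<close>

lemma sum_of_bool_mult:
  "(\<Sum>x\<in>UNIV. of_bool (x = a) * f x) = f a"
  "(\<Sum>x\<in>UNIV. of_bool (a = x) * f x) = f a"
  for f :: "'c::finite \<Rightarrow> int"
  by (simp_all add: of_bool_def if_distrib[of "\<lambda>t. t * _"] sum.delta sum.delta' cong: if_cong)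

lemma sum_of_bool_mult2:
  "(\<Sum>x\<in>UNIV. \<Sum>y\<in>UNIV. of_bool (x = a) * f x y) = (\<Sum>y\<in>UNIV. f a y)"
  "(\<Sum>x\<in>UNIV. \<Sum>y\<in>UNIV. of_bool (a = x) * f x y) = (\<Sum>y\<in>UNIV. f a y)"
  for f :: "'c::finite \<Rightarrow> 'c \<Rightarrow> int"
  by (simp_all add: sum_distrib_left[symmetric] sum_of_bool_mult)

text \<open>Transfer from the corners at one end of an untwisted quadrilateral edge to those at the next
  spoke, and the transfer past two spokes.\<close>

definition transfer :: "('c \<Rightarrow> 'c \<Rightarrow> int) \<Rightarrow> 'c \<Rightarrow> 'c \<Rightarrow> 'c \<Rightarrow> 'c \<Rightarrow> int" where
  "transfer w a m a' m' = of_bool (m = m') * w a' a - of_bool (a = m') * w a' m"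

definition transfer2 ::
    "('c::finite \<Rightarrow> 'c \<Rightarrow> int) \<Rightarrow> ('c \<Rightarrow> 'c \<Rightarrow> int) \<Rightarrow> 'c \<Rightarrow> 'c \<Rightarrow> 'c \<Rightarrow> 'c \<Rightarrow> int" where
  "transfer2 v w a m b l = of_bool (m = l) * compose w v b a - of_bool (a = l) * compose w v b m
     - v l a * w b m + v l m * w b a"

lemma strand_False:
  "strand False a b a' b' = of_bool (a = b') * of_bool (b = a') - of_bool (a = a') * of_bool (b = b')"
  by (simp only: strand_def joined_def of_bool_conj simp_thms if_True if_False)

text \<open>The corner \<open>b\<close> before the next spoke is forced to be \<open>a\<close> by
  parallel strands and \<open>m\<close> by crossed ones.\<close>

lemma transfer_eq_sum:
  "(\<Sum>b\<in>UNIV. w a' b * strand False m a b m') = transfer w a m a' m'"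
  for w :: "'c::finite \<Rightarrow> 'c \<Rightarrow> int"
proof -
  have "(\<Sum>b\<in>UNIV. w a' b * strand False m a b m') =
      (\<Sum>b\<in>UNIV. of_bool (a = b) * (of_bool (m = m') * w a' b) - of_bool (m = b) * (of_bool (a = m') * w a' b))"
    unfolding strand_False
    by (simp only: right_diff_distrib mult.assoc mult.commute mult.left_commute)
  then show ?thesis
    by (simp only: sum_subtractf sum_of_bool_mult transfer_def)
qed

text \<open>The four terms of \<open>transfer2\<close> are the choices parallel or crossed at the
  two edges. If the second edge is parallel, \<open>a'\<close> stays free and its sum is a matrix
  product; if it is crossed, \<open>a'\<close> is forced to be \<open>l\<close>.\<close>

lemma transfer2_eq_sum:
  "(\<Sum>a'\<in>UNIV. \<Sum>m'\<in>UNIV. transfer v a m a' m' * transfer w a' m' b l) = transfer2 v w a m b l"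
proof -
  have inner: "(\<Sum>m'\<in>UNIV. transfer v a m a' m' * transfer w a' m' b l) =
      of_bool (m = l) * (w b a' * v a' a) - of_bool (a = l) * (w b a' * v a' m)
      + of_bool (l = a') * (v a' m * w b a - v a' a * w b m)" for a'
  proof -
    have "(\<Sum>m'\<in>UNIV. transfer v a m a' m' * transfer w a' m' b l) =
       (\<Sum>m'\<in>UNIV. of_bool (m = m') * (v a' a * transfer w a' m' b l)
          - of_bool (a = m') * (v a' m * transfer w a' m' b l))"
      unfolding transfer_def[of v] left_diff_distrib mult.assoc ..
    also have "\<dots> = v a' a * transfer w a' m b l - v a' m * transfer w a' a b l"
      by (simp only: sum_subtractf sum_of_bool_mult)
    finally show ?thesis
      by (simp add: transfer_def algebra_simps eq_commute[of l a'])
  qed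
  show ?thesis
    unfolding inner
    by (simp add: sum.distrib sum_subtractf sum_of_bool_mult sum_distrib_left[symmetric] transfer2_def
        compose_def)
qed

section \<open>Traces and pairings of the local configurations\<close>

definition pairing :: "('c::finite \<Rightarrow> 'c \<Rightarrow> int) \<Rightarrow> ('c \<Rightarrow> 'c \<Rightarrow> int) \<Rightarrow> int" where
  "pairing v w = (\<Sum>a\<in>UNIV. \<Sum>b\<in>UNIV. v a b * w a b)"

lemma tr_compose_pairing:
  assumes "antisym_fun v"
  shows "tr (compose w v) = - pairing v w"
proof -
  have flip: "v b a = - v a b" for a b
    using assms unfolding antisym_fun_def by blast
  show ?thesis
    unfolding tr_compose2 pairing_def sum_negf[symmetric]
  proof (intro sum.cong refl)
    fix a b
    show "w a b * v b a = - (v a b * w a b)"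
      unfolding flip[of b a] by simp
  qed
qed

text \<open>In the square, \<open>ai\<close>, \<open>mi\<close>, \<open>bi\<close> are the colours of the corners at the vertex of spoke \<open>i\<close> in
  clockwise order from the spoke, so that \<open>mi\<close> lies in the quadrilateral face. In \<open>H\<close> and at the 4-valent
  vertex, \<open>xi\<close> is the corner following spoke \<open>i\<close>; in \<open>H\<close>, \<open>f\<close> and \<open>f'\<close> are the corners following
  the two halves of the new edge.\<close>

definition square_sum where
  "square_sum w1 w2 w3 w4 =
    (\<Sum>a4\<in>UNIV. \<Sum>m4\<in>UNIV. \<Sum>a2\<in>UNIV. \<Sum>m2\<in>UNIV. \<Sum>a1\<in>UNIV. \<Sum>m1\<in>UNIV. \<Sum>a3\<in>UNIV. \<Sum>m3\<in>UNIV.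
     \<Sum>b1\<in>UNIV. \<Sum>b2\<in>UNIV. \<Sum>b3\<in>UNIV. \<Sum>b4\<in>(UNIV :: 'c::finite set).
       w1 a1 b1 * w2 a2 b2 * w3 a3 b3 * w4 a4 b4 *
       strand False m1 a1 b2 m2 * strand False m2 a2 b3 m3 *
       strand False m3 a3 b4 m4 * strand False m4 a4 b1 m1)"

definition H_sum where
  "H_sum w1 w2 w3 w4 =
    (\<Sum>x1\<in>UNIV. \<Sum>x2\<in>UNIV. \<Sum>x3\<in>UNIV. \<Sum>x4\<in>UNIV. \<Sum>f\<in>UNIV. \<Sum>f'\<in>(UNIV :: 'c::finite set).
       w1 x1 f * w2 x2 x1 * w3 x3 f' * w4 x4 x3 * strand False f x2 f' x4)"

definition vertex_sum where
  "vertex_sum w1 w2 w3 w4 =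
    (\<Sum>x1\<in>UNIV. \<Sum>x2\<in>UNIV. \<Sum>x3\<in>UNIV. \<Sum>x4\<in>(UNIV :: 'c::finite set).
       w1 x1 x4 * w2 x2 x1 * w3 x3 x2 * w4 x4 x3)"

text \<open>Going once around the face composes four transfers cyclically. The order of the sums in
  \<open>square_sum\<close> puts the \<open>b\<close> corners innermost, then the corners at spokes
  1 and 3; those at spokes 4 and 2 remain as \<open>a\<close>, \<open>m\<close> and
  \<open>b\<close>, \<open>l\<close>.\<close>

lemma square_sum_transfer2:
  "square_sum w1 w2 w3 w4 = sum4 (\<lambda>a m b l. transfer2 w1 w2 a m b l * transfer2 w3 w4 b l a m)"
proof -
  have inner: "(\<Sum>b1\<in>UNIV. \<Sum>b2\<in>UNIV. \<Sum>b3\<in>UNIV. \<Sum>b4\<in>(UNIV :: 'a set).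
       w1 a1 b1 * w2 a2 b2 * w3 a3 b3 * w4 a4 b4 *
       strand False m1 a1 b2 m2 * strand False m2 a2 b3 m3 *
       strand False m3 a3 b4 m4 * strand False m4 a4 b1 m1) =
     (transfer w1 a4 m4 a1 m1 * transfer w2 a1 m1 a2 m2) *
     (transfer w3 a2 m2 a3 m3 * transfer w4 a3 m3 a4 m4)" for a1 a2 a3 a4 m1 m2 m3 m4
  proof -
    have "w1 a1 b1 * w2 a2 b2 * w3 a3 b3 * w4 a4 b4 *
        strand False m1 a1 b2 m2 * strand False m2 a2 b3 m3 *
        strand False m3 a3 b4 m4 * strand False m4 a4 b1 m1 =
        (w1 a1 b1 * strand False m4 a4 b1 m1) * ((w2 a2 b2 * strand False m1 a1 b2 m2) *
        ((w3 a3 b3 * strand False m2 a2 b3 m3) * (w4 a4 b4 * strand False m3 a3 b4 m4)))" for b1 b2 b3 b4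
      by (simp only: mult.assoc mult.commute mult.left_commute)
    then show ?thesis
      by (simp only: sum_distrib_left[symmetric] sum_distrib_right[symmetric] transfer_eq_sum)
  qed
  show ?thesis
    unfolding square_sum_def inner sum4_def
    by (simp only: sum_distrib_left[symmetric] sum_distrib_right[symmetric] transfer2_eq_sum)
qed

text \<open>The sixteen terms correspond to the sets of crossed edges of the quadrilateral. None
  crossed: the colour of the face is free, which gives n times \<open>?X\<close>. One: minus
  \<open>?X\<close>, in four ways. Two opposite edges: the product of pairings of the spokes still
  linked by a parallel edge. Two adjacent edges: the spoke between them is evaluated on its
  diagonal, so 0. Three: minus \<open>?Y\<close> or minus \<open>?Z\<close>, each in two ways. All
  four: the pairings of opposite spokes.\<close>

lemma square_sum_tr:
  assumes w: "antisym_fun w1" "antisym_fun w2" "antisym_fun w3" "antisym_fun w4"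
  shows "square_sum w1 w2 w3 w4 =
    (int CARD('c::finite) - 4) * tr (compose w1 (compose w2 (compose w3 w4)))
    - 2 * tr (compose w1 (compose w3 (compose w4 w2))) - 2 * tr (compose w1 (compose w3 (compose w2 w4)))
    + pairing w1 w2 * pairing w3 w4 + pairing w1 w4 * pairing w2 w3 + pairing w1 w3 * pairing w2 (w4 :: 'c \<Rightarrow> _)"
proof -
  let ?X = "tr (compose w1 (compose w2 (compose w3 w4)))"
  let ?Y = "tr (compose w1 (compose w3 (compose w4 w2)))"
  let ?Z = "tr (compose w1 (compose w3 (compose w2 w4)))"
  define A B where "A = compose w2 w1" and "B = compose w4 w3"
  have diag: "w a a = 0" if "antisym_fun w" for w :: "'c \<Rightarrow> 'c \<Rightarrow> int" and a
    using that unfolding antisym_fun_def by (metis equal_neg_zero)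
  \<comment> \<open>The contractions produce the words in various cyclic orders; rotation and
    reversal bring each to one of the three representatives.\<close>
  have X1: "tr (compose B A) = ?X" "tr (compose w4 (compose w3 A)) = ?X" "tr (compose B (compose w2 w1)) = ?X"
    unfolding A_def B_def compose_assoc using tr_reverse4[OF w] by simp_all
  have Y1: "tr (compose w4 (compose A w3)) = ?Y"
    unfolding A_def compose_assoc by (simp add: tr_rotate4[of w4] tr_rotate4[of w2])
  have Y2: "tr (compose B (compose w1 w2)) = ?Y"
    unfolding B_def compose_assoc using tr_reverse4[OF w(4,3,1,2)] tr_rotate4[of w2] by simp
  have Z1: "tr (compose w1 (compose w4 (compose w2 w3))) = ?Z"
    using tr_reverse4[OF w(1,4,2,3)] by (simp add: tr_rotate4[of w3] tr_rotate4[of w2] tr_rotate4[of w4])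
  have Z2: "tr (compose w4 (compose w1 (compose w3 w2))) = ?Z"
    by (rule tr_rotate4)
  have "transfer2 w1 w2 a m b l * transfer2 w3 w4 b l a m =
      of_bool (m = l) * (of_bool (l = m) * (B a b * A b a))
    - of_bool (m = l) * (of_bool (b = m) * (B a l * A b a))
    - of_bool (m = l) * (w4 a l * w3 m b * A b a)
    + of_bool (m = l) * (w3 m l * (w4 a b * A b a))
    - of_bool (a = l) * (of_bool (l = m) * (B a b * A b m))
    + of_bool (a = l) * (of_bool (b = m) * (A b m * B a l))
    + of_bool (a = l) * (w4 a l * (w3 m b * A b m))
    - of_bool (a = l) * (w4 a b * A b m * w3 m l)
    - of_bool (m = l) * (B a b * w2 b m * w1 l a)
    + of_bool (b = m) * (w2 b m * (w1 l a * B a l))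
    + (w4 a l * w1 l a) * (w3 m b * w2 b m)
    - (w1 l a * w4 a b * w2 b m * w3 m l)
    + of_bool (m = l) * (w1 l m * (w2 b a * B a b))
    - of_bool (b = m) * (B a l * w1 l m * w2 b a)
    - (w4 a l * w1 l m * w3 m b * w2 b a)
    + (w3 m l * w1 l m) * (w4 a b * w2 b a)" for a m b l
    unfolding transfer2_def A_def[symmetric] B_def[symmetric] eq_commute[of l m]
    by (simp only: algebra_simps)
  moreover have "sum4 (\<lambda>a m b l. of_bool (m = l) * (of_bool (l = m) * (B a b * A b a))) = int CARD('c) * ?X"
    unfolding X1(1)[symmetric] unfolding tr_compose2 by (simp add: sum4_def sum_of_bool_mult sum_distrib_left)
  moreover have "sum4 (\<lambda>a m b l. of_bool (m = l) * (of_bool (b = m) * (B a l * A b a))) = ?X"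
    unfolding X1(1)[symmetric] unfolding tr_compose2 by (simp only: sum4_def sum_of_bool_mult)
  moreover have "sum4 (\<lambda>a m b l. of_bool (m = l) * (w4 a l * w3 m b * A b a)) = ?X"
    unfolding X1(2)[symmetric] unfolding tr_compose3 by (simp only: sum4_def sum_of_bool_mult)
  moreover have "sum4 (\<lambda>a m b l. of_bool (m = l) * (w3 m l * (w4 a b * A b a))) = 0"
    by (simp only: sum4_def sum_of_bool_mult) (simp add: diag w)
  moreover have "sum4 (\<lambda>a m b l. of_bool (a = l) * (of_bool (l = m) * (B a b * A b m))) = ?X"
    unfolding X1(1)[symmetric] unfolding tr_compose2 by (simp only: sum4_def sum_of_bool_mult sum_of_bool_mult2)
  moreover have "sum4 (\<lambda>a m b l. of_bool (a = l) * (of_bool (b = m) * (A b m * B a l))) =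
      pairing w1 w2 * pairing w3 w4"
  proof -
    have "pairing w1 w2 = - tr A" "pairing w3 w4 = - tr B"
      by (simp_all add: A_def B_def tr_compose_pairing w)
    then show ?thesis
      by (simp add: sum4_def sum_of_bool_mult tr_def sum_distrib_left sum_distrib_right mult.commute sum_product)
  qed
  moreover have "sum4 (\<lambda>a m b l. of_bool (a = l) * (w4 a l * (w3 m b * A b m))) = 0"
    by (simp only: sum4_def sum_of_bool_mult) (simp add: diag w)
  moreover have "sum4 (\<lambda>a m b l. of_bool (a = l) * (w4 a b * A b m * w3 m l)) = ?Y"
    unfolding Y1[symmetric] unfolding tr_compose3 by (simp only: sum4_def sum_of_bool_mult) (intro sum.cong refl sum.swap)
  moreover have "sum4 (\<lambda>a m b l. of_bool (m = l) * (B a b * w2 b m * w1 l a)) = ?X"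
    unfolding X1(3)[symmetric] unfolding tr_compose3 by (simp only: sum4_def sum_of_bool_mult) (intro sum.cong refl sum.swap)
  moreover have "sum4 (\<lambda>a m b l. of_bool (b = m) * (w2 b m * (w1 l a * B a l))) = 0"
    by (simp only: sum4_def sum_of_bool_mult2) (simp add: diag w)
  moreover have "sum4 (\<lambda>a m b l. (w4 a l * w1 l a) * (w3 m b * w2 b m)) = pairing w1 w4 * pairing w2 w3"
  proof -
    have "sum4 (\<lambda>a m b l. (w4 a l * w1 l a) * (w3 m b * w2 b m)) =
        sum4 (\<lambda>a l m b. (w4 a l * w1 l a) * (w3 m b * w2 b m))"
      by (subst sum4_swap34[symmetric], subst sum4_swap23[symmetric]) simp
    also have "\<dots> = tr (compose w4 w1) * tr (compose w3 w2)"
      by (simp add: sum4_def tr_compose2 sum_distrib_left[symmetric] sum_distrib_right[symmetric])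
    finally show ?thesis
      by (simp add: tr_compose_pairing w)
  qed
  moreover have "sum4 (\<lambda>a m b l. w1 l a * w4 a b * w2 b m * w3 m l) = ?Z"
  proof -
    have "sum4 (\<lambda>a m b l. w1 l a * w4 a b * w2 b m * w3 m l) = sum4 (\<lambda>l a b m. w1 l a * w4 a b * w2 b m * w3 m l)"
      by (subst sum4_swap12[symmetric], subst sum4_swap23[symmetric], subst sum4_swap34[symmetric], 
          subst sum4_swap23[symmetric]) simp
    then show ?thesis
      by (simp add: sum4_tr Z1)
  qed
  moreover have "sum4 (\<lambda>a m b l. of_bool (m = l) * (w1 l m * (w2 b a * B a b))) = 0"
    by (simp only: sum4_def sum_of_bool_mult) (simp add: diag w)
  moreover have "sum4 (\<lambda>a m b l. of_bool (b = m) * (B a l * w1 l m * w2 b a)) = ?Y"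
    unfolding Y2[symmetric] unfolding tr_compose3 by (simp only: sum4_def sum_of_bool_mult2) (intro sum.cong refl sum.swap)
  moreover have "sum4 (\<lambda>a m b l. w4 a l * w1 l m * w3 m b * w2 b a) = ?Z"
  proof -
    have "sum4 (\<lambda>a m b l. w4 a l * w1 l m * w3 m b * w2 b a) = sum4 (\<lambda>a l m b. w4 a l * w1 l m * w3 m b * w2 b a)"
      by (subst sum4_swap34[symmetric], subst sum4_swap23[symmetric]) simp
    then show ?thesis
      by (simp add: sum4_tr Z2)
  qed
  moreover have "sum4 (\<lambda>a m b l. (w3 m l * w1 l m) * (w4 a b * w2 b a)) = pairing w1 w3 * pairing w2 w4"
  proof -
    have "sum4 (\<lambda>a m b l. (w3 m l * w1 l m) * (w4 a b * w2 b a)) =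
        sum4 (\<lambda>a b m l. (w3 m l * w1 l m) * (w4 a b * w2 b a))"
      by (subst sum4_swap23[symmetric]) simp
    also have "\<dots> = tr (compose w3 w1) * tr (compose w4 w2)"
      by (simp add: sum4_def tr_compose2 sum_distrib_left[symmetric] sum_distrib_right[symmetric])
    finally show ?thesis
      by (simp add: tr_compose_pairing w)
  qed
  ultimately show ?thesis
    unfolding square_sum_transfer2 by (simp only: sum4_add sum4_diff) (simp add: algebra_simps)
qed

text \<open>Chaining the corners visits the spokes counterclockwise and yields the word 1432, which
  is 1234 reversed and rotated.\<close>

lemma vertex_sum_tr:
  assumes w: "antisym_fun w1" "antisym_fun w2" "antisym_fun w3" "antisym_fun w4"
  shows "vertex_sum w1 w2 w3 w4 = tr (compose w1 (compose w2 (compose w3 w4)))"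
proof -
  have "vertex_sum w1 w2 w3 w4 = sum4 (\<lambda>x1 x2 x3 x4. w1 x1 x4 * w4 x4 x3 * w3 x3 x2 * w2 x2 x1)"
    unfolding vertex_sum_def sum4_def by (simp only: ac_simps)
  also have "\<dots> = sum4 (\<lambda>x1 x4 x3 x2. w1 x1 x4 * w4 x4 x3 * w3 x3 x2 * w2 x2 x1)"
    by (subst sum4_swap23[symmetric], subst sum4_swap34[symmetric], subst sum4_swap23[symmetric]) simp
  also have "\<dots> = tr (compose w1 (compose w2 (compose w3 w4)))"
    unfolding sum4_tr using tr_reverse4[OF w(1,4,3,2)] by (simp add: tr_rotate4[of w2] tr_rotate4[of w3] tr_rotate4[of w4])
  finally show ?thesis .
qed

text \<open>The parallel strands contract the new edge to the 4-valent vertex. The crossed strands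
  contract it after turning one end over, which exchanges spokes 3 and 4 in the cyclic order; the
  two signs from transposing \<open>w3\<close> and \<open>w4\<close> cancel.\<close>

lemma H_sum_tr:
  assumes w: "antisym_fun w1" "antisym_fun w2" "antisym_fun w3" "antisym_fun w4"
  shows "H_sum w1 w2 w3 w4 =
    tr (compose w1 (compose w2 (compose w3 w4))) - tr (compose w1 (compose w3 (compose w4 w2)))"
proof -
  have "(\<Sum>f\<in>UNIV. \<Sum>f'\<in>UNIV. w1 x1 f * w2 x2 x1 * w3 x3 f' * w4 x4 x3 * strand False f x2 f' x4) =
      w1 x1 x4 * w2 x2 x1 * w3 x3 x2 * w4 x4 x3
      - of_bool (x4 = x2) * (\<Sum>f\<in>UNIV. w1 x1 f * w3 f x3 * w4 x3 x4 * w2 x2 x1)" for x1 x2 x3 x4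
  proof -
    have "w3 x3 f = - w3 f x3" "w4 x4 x3 = - w4 x3 x4" for f
      using w unfolding antisym_fun_def by blast+
    then have flip: "w1 x1 f * w2 x2 x1 * w3 x3 f * w4 x4 x3 = w1 x1 f * w3 f x3 * w4 x3 x4 * w2 x2 x1" for f
      by simp
    have "(\<Sum>f'\<in>UNIV. w1 x1 f * w2 x2 x1 * w3 x3 f' * w4 x4 x3 * strand False f x2 f' x4) =
       (\<Sum>f'\<in>UNIV. of_bool (x2 = f') * (of_bool (f = x4) * (w1 x1 f * w2 x2 x1 * w3 x3 f' * w4 x4 x3))
         - of_bool (f = f') * (of_bool (x4 = x2) * (w1 x1 f * w2 x2 x1 * w3 x3 f' * w4 x4 x3)))" for f
      by (intro sum.cong refl) (simp only: strand_False right_diff_distrib eq_commute[of x2 x4]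
          mult.assoc mult.commute mult.left_commute)
    then show ?thesis
      by (simp only: sum_subtractf sum_of_bool_mult flip) (simp only: sum_distrib_left[symmetric])
  qed
  then have "H_sum w1 w2 w3 w4 = vertex_sum w1 w2 w3 w4 -
      (\<Sum>x1\<in>UNIV. \<Sum>x2\<in>UNIV. \<Sum>x3\<in>UNIV. \<Sum>x4\<in>UNIV.
        of_bool (x4 = x2) * (\<Sum>f\<in>UNIV. w1 x1 f * w3 f x3 * w4 x3 x4 * w2 x2 x1))"
    unfolding H_sum_def vertex_sum_def by (simp only: sum_subtractf)
  also have "(\<Sum>x1\<in>UNIV. \<Sum>x2\<in>UNIV. \<Sum>x3\<in>UNIV. \<Sum>x4\<in>UNIV.
        of_bool (x4 = x2) * (\<Sum>f\<in>UNIV. w1 x1 f * w3 f x3 * w4 x3 x4 * w2 x2 x1)) =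
      sum4 (\<lambda>x1 x2 x3 f. w1 x1 f * w3 f x3 * w4 x3 x2 * w2 x2 x1)"
    unfolding sum4_def by (simp only: sum_of_bool_mult)
  also have "\<dots> = sum4 (\<lambda>x1 f x3 x2. w1 x1 f * w3 f x3 * w4 x3 x2 * w2 x2 x1)"
    by (subst sum4_swap23[symmetric], subst sum4_swap34[symmetric], subst sum4_swap23[symmetric]) simp
  finally show ?thesis
    unfolding sum4_tr vertex_sum_tr[OF w] .
qed

text \<open>The square has coefficient n - 4 at the trace of 1234, while \<open>H\<close> and
  \<open>I\<close> bring 2 + 2. The 4-valent vertex must supply the remaining n - 8, hence -4 at n =
  4. The other two traces and the three pairings match directly.\<close>

theorem square_sum_identity:
  fixes w1 w2 w3 w4 :: "'c::finite \<Rightarrow> 'c \<Rightarrow> int"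
  assumes w: "antisym_fun w1" "antisym_fun w2" "antisym_fun w3" "antisym_fun w4"
    and "CARD('c) = 4"
  shows "square_sum w1 w2 w3 w4 = 2 * H_sum w1 w2 w3 w4 + 2 * H_sum w2 w3 w4 w1
    + pairing w1 w4 * pairing w2 w3 + pairing w1 w2 * pairing w3 w4 + pairing w1 w3 * pairing w2 w4
    - 4 * vertex_sum w1 w2 w3 w4"
proof -
  have "tr (compose w2 (compose w3 (compose w4 w1))) = tr (compose w1 (compose w2 (compose w3 w4)))"
    by (rule tr_rotate4[symmetric])
  moreover have "tr (compose w2 (compose w4 (compose w1 w3))) = tr (compose w1 (compose w3 (compose w2 w4)))"
    by (rule tr_rotate4[THEN trans, OF tr_rotate4])
  ultimately show ?thesis
    using assms(5) by (simp add: square_sum_tr H_sum_tr vertex_sum_tr w)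
qed

section \<open>Replacing the inside of a disc\<close>

text \<open>The outermost \<open>insert\<close> becomes the innermost sum. The inner half-edges of
  each configuration are listed in the order that turns repeated use of this rule into the local sum
  as defined.\<close>

lemma sum_PiE_insert:
  assumes "i \<notin> S"
  shows "(\<Sum>x \<in> insert i S \<rightarrow>\<^sub>E A. F x) = (\<Sum>y \<in> S \<rightarrow>\<^sub>E A. \<Sum>c \<in> A. F (y(i := c)))"
proof -
  have "(\<Sum>x \<in> insert i S \<rightarrow>\<^sub>E A. F x) = (\<Sum>(c, y) \<in> A \<times> (S \<rightarrow>\<^sub>E A). F (y(i := c)))"
    unfolding PiE_insert_eq
    by (subst sum.reindex[OF inj_combinator[OF assms]]) (simp add: case_prod_unfold)
  also have "\<dots> = (\<Sum>c \<in> A. \<Sum>y \<in> S \<rightarrow>\<^sub>E A. F (y(i := c)))"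
    by (rule sum.cartesian_product[symmetric])
  also have "\<dots> = (\<Sum>y \<in> S \<rightarrow>\<^sub>E A. \<Sum>c \<in> A. F (y(i := c)))"
    by (rule sum.swap)
  finally show ?thesis .
qed

lemma exists_transversal:
  assumes "\<And>h. h \<in> S \<Longrightarrow> f (f h) = h" "\<And>h. h \<in> S \<Longrightarrow> f h \<noteq> h" "\<And>h. h \<in> S \<Longrightarrow> f h \<in> S"
  shows "\<exists>T \<subseteq> S. \<forall>h \<in> S. f h \<in> T \<longleftrightarrow> h \<notin> T"
proof (intro exI conjI ballI)
  \<comment> \<open>The choice depends only on the set \<open>{h, f h}\<close>, so \<open>h\<close>
    and \<open>f h\<close> agree on which of them is chosen.\<close>
  let ?T = "{h \<in> S. h = (SOME k. k \<in> {h, f h})}"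
  show "?T \<subseteq> S" by blast
  fix h assume h: "h \<in> S"
  define c where "c = (SOME k. k \<in> {h, f h})"
  have c: "c \<in> {h, f h}"
    unfolding c_def by (rule someI[of _ h]) simp
  have "{f h, f (f h)} = {h, f h}"
    using assms(1)[OF h] by auto
  then have "f h \<in> ?T \<longleftrightarrow> f h = c" "h \<in> ?T \<longleftrightarrow> h = c"
    using h assms(3)[OF h] by (simp_all only: c_def mem_Collect_eq simp_thms)
  then show "f h \<in> ?T \<longleftrightarrow> h \<notin> ?T"
    using c assms(2)[OF h] by auto
qed

lemma (in half_edge_system) prev_half_eq:
  "k \<in> halfs G \<Longrightarrow> nxt G k = h \<Longrightarrow> prev_half G h = k"
  using prev_nxt by auto

text \<open>The matrix of a spoke: rows and columns are the corners at its end inside the disc, and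
  the corners at the far end are parameters read off from \<open>x\<close>.\<close>

definition spoke :: "('v, 'h) rgraph \<Rightarrow> ('h \<Rightarrow> 'c) \<Rightarrow> 'h \<Rightarrow> 'c \<Rightarrow> 'c \<Rightarrow> int" where
  "spoke G x s a b = strand (twist G s) a b (x (opp G s)) (x (prev_half G (opp G s)))"

lemma antisym_fun_strand: "antisym_fun (\<lambda>a b. strand t a b p q)"
  unfolding antisym_fun_def strand_def joined_def by (cases t) (simp_all only: if_True if_False simp_thms minus_diff_eq conj_commute)

lemma antisym_fun_spoke: "antisym_fun (spoke G x s)"
  unfolding spoke_def[abs_def] by (rule antisym_fun_strand)

lemma strand_sign: "strand t a b p q = (if t then -1 else 1) * strand False a b p q"
  by (cases t) (simp_all only: strand_def if_True if_False simp_thms mult_1 mult_minus_left minus_diff_eq)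

text \<open>As a matrix, the untwisted strand is 1 at \<open>(q, p)\<close> and -1 at
  \<open>(p, q)\<close>, or zero if \<open>p = q\<close>. Pairing with it takes the difference of
  two opposite entries of an antisymmetric matrix, whence the 2. Each half-twist is a sign, so
  twists add modulo 2 when spokes are joined.\<close>

lemma pairing_strand:
  "pairing (\<lambda>a b. strand t a b p q) (\<lambda>a b. strand t' a b p' q') = - 2 * strand (t \<noteq> t') p q p' (q' :: 'c::finite)"
proof -
  have "pairing (\<lambda>a b. strand False a b p q) (\<lambda>a b. strand False a b p' q') =
      (\<Sum>a\<in>UNIV. \<Sum>b\<in>UNIV.
         of_bool (a = q) * (of_bool (b = p) * strand False a b p' q')
       - of_bool (a = p) * (of_bool (b = q) * strand False a b p' q'))"
    unfolding pairing_def strand_False[of _ _ p q] by (simp only: left_diff_distrib mult.assoc)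
  also have "\<dots> = strand False q p p' q' - strand False p q p' q'"
    by (simp only: sum_subtractf sum_of_bool_mult sum_of_bool_mult2)
  also have "\<dots> = - 2 * strand False p q p' q'"
    by (simp only: strand_False mult.commute) simp
  finally have 1: "pairing (\<lambda>a b. strand False a b p q) (\<lambda>a b. strand False a b p' q') =
      - 2 * strand False p q p' q'" .
  show ?thesis
    unfolding strand_sign[of t] strand_sign[of t'] strand_sign[of "t \<noteq> t'"]
    using 1 by (cases t; cases t') (simp_all add: pairing_def sum_negf)
qed

definition outer_weight :: "('v, 'h) rgraph \<Rightarrow> 'h set \<Rightarrow> ('h \<Rightarrow> 'c) \<Rightarrow> int" where
  "outer_weight G T x = (\<Prod>h\<in>T. strand_at G x h)"

text \<open>The set \<open>T\<close> contains one half of each edge that does not meet the disc of the configuration.\<close>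

locale four_spokes = ribbon_graph G
  for G :: "('v, 'h) rgraph" +
  fixes s1 s2 s3 s4 :: 'h and T :: "'h set"
  assumes no_isolated: "verts G \<subseteq> base G ` halfs G"
    and spokes_in: "{s1, s2, s3, s4} \<subseteq> halfs G"
    and spokes_distinct: "distinct [s1, s2, s3, s4]"
    and opp_spokes: "opp G ` {s1, s2, s3, s4} \<subseteq> outer_halfs G s1 s2 s3 s4"
    and opp_outer: "h \<in> outer_halfs G s1 s2 s3 s4 \<Longrightarrow>
      opp G h \<in> outer_halfs G s1 s2 s3 s4 \<union> {s1, s2, s3, s4}"
    and T_outer: "T \<subseteq> outer_halfs G s1 s2 s3 s4 - opp G ` {s1, s2, s3, s4}"
    and T_transversal: "h \<in> outer_halfs G s1 s2 s3 s4 - opp G ` {s1, s2, s3, s4} \<Longrightarrow>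
      opp G h \<in> T \<longleftrightarrow> h \<notin> T"
begin

abbreviation outer :: "'h set" where
  "outer \<equiv> outer_halfs G s1 s2 s3 s4"

lemma outer_in: "h \<in> outer \<Longrightarrow> h \<in> halfs G"
  by (simp add: outer_halfs_def)

lemma finite_outer: "finite outer"
  using finite_halfs by (simp add: outer_halfs_def)

lemma spokes_not_outer: "s1 \<notin> outer" "s2 \<notin> outer" "s3 \<notin> outer" "s4 \<notin> outer"
  by (simp_all add: outer_halfs_def quad_verts_def)

lemma spokes_neq:
  "s1 \<noteq> s2" "s1 \<noteq> s3" "s1 \<noteq> s4" "s2 \<noteq> s1" "s2 \<noteq> s3" "s2 \<noteq> s4"
  "s3 \<noteq> s1" "s3 \<noteq> s2" "s3 \<noteq> s4" "s4 \<noteq> s1" "s4 \<noteq> s2" "s4 \<noteq> s3"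
  using spokes_distinct by auto

lemma opp_spokes_outer: "opp G s1 \<in> outer" "opp G s2 \<in> outer" "opp G s3 \<in> outer" "opp G s4 \<in> outer"
  using opp_spokes by auto

lemma opp_opp_spokes:
  "opp G (opp G s1) = s1" "opp G (opp G s2) = s2" "opp G (opp G s3) = s3" "opp G (opp G s4) = s4"
  using opp_opp spokes_in by auto

lemma opp_outer':
  assumes "h \<in> outer" "h \<notin> opp G ` {s1, s2, s3, s4}"
  shows "opp G h \<in> outer - opp G ` {s1, s2, s3, s4}"
proof -
  have "opp G (opp G h) = h"
    using assms outer_in opp_opp by blast
  moreover have "opp G h \<notin> {s1, s2, s3, s4}"
    using assms(2) calculation by (metis image_eqI)
  moreover have "h \<notin> {s1, s2, s3, s4}"
    using assms(1) spokes_not_outer by blast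
  ultimately show ?thesis
    using opp_outer[OF assms(1)] opp_opp_spokes by auto
qed

lemma T_in_outer: "h \<in> T \<Longrightarrow> h \<in> outer" "h \<in> T \<Longrightarrow> opp G h \<in> outer"
  using T_outer opp_outer' by blast+

lemma nxt_outer: "h \<in> outer \<Longrightarrow> nxt G h \<in> outer"
  by (simp add: outer_halfs_def nxt_in base_nxt)

lemma prev_outer:
  assumes "h \<in> outer"
  shows "prev_half G h \<in> outer"
proof -
  have "h \<in> halfs G"
    using assms outer_in by blast
  then have "base G (prev_half G h) = base G h"
    using base_nxt[of "prev_half G h"] by (simp add: prev_in nxt_prev)
  then show ?thesis
    using assms by (simp add: outer_halfs_def prev_in)
qed

lemma bij_betw_nxt_outer: "bij_betw (nxt G) outer outer"
proof -
  have "inj_on (nxt G) outer"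
    using nxt_bij outer_in by (meson bij_betw_def inj_on_subset subsetI)
  then show ?thesis
    using finite_outer nxt_outer by (simp add: bij_betw_def endo_inj_surj image_subsetI)
qed

text \<open>The corners seen by an edge of \<open>T\<close> all lie at outer vertices. With the
  analogous rule for \<open>spoke\<close>, this moves the outer factors out of the sums over inner
  colours.\<close>

lemma outer_weight_upd [simp]: "i \<notin> outer \<Longrightarrow> outer_weight G T (x(i := c)) = outer_weight G T x"
  unfolding outer_weight_def
proof (rule prod.cong[OF refl])
  fix h assume "i \<notin> outer" "h \<in> T"
  then show "strand_at G (x(i := c)) h = strand_at G x h"
    using T_in_outer[of h] prev_outer[of h] prev_outer[of "opp G h"]
    by (auto simp: strand_at_def)
qed

lemma spoke_upd [simp]:
  assumes "i \<notin> outer" "s \<in> {s1, s2, s3, s4}"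
  shows "spoke G (x(i := c)) s = spoke G x s"
proof -
  have "opp G s \<in> outer"
    using assms(2) opp_spokes by blast
  then show ?thesis
    using assms(1) prev_outer[of "opp G s"] by (auto simp: spoke_def fun_eq_iff)
qed

section \<open>State sums after a replacement\<close>

lemma replacement_half_edge_system:
  assumes halfs: "halfs G' = I \<union> outer" "I \<inter> outer = {}" "finite I"
    and nxt: "\<And>h. h \<in> outer \<Longrightarrow> nxt G' h = nxt G h" "bij_betw (nxt G') I I"
    and opp: "\<And>h. h \<in> halfs G' \<Longrightarrow>
      opp G' h \<in> halfs G' \<and> opp G' (opp G' h) = h \<and> twist G' (opp G' h) = twist G' h"
  shows "half_edge_system G'"
proof
  show "finite (halfs G')"
    using halfs finite_outer by simp
  have "bij_betw (nxt G') outer outer"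
    using bij_betw_nxt_outer nxt(1) by (simp cong: bij_betw_cong)
  then show "bij_betw (nxt G') (halfs G') (halfs G')"
    unfolding halfs(1) using nxt(2) halfs(2) by (intro bij_betw_combine) auto
qed (use opp in auto)

text \<open>Since \<open>nxt\<close> is unchanged outside, so is the corner before an outer
  half-edge, and the edges of \<open>T\<close> keep their factors from \<open>G\<close>.
  \<open>K\<close> represents the edges that meet the disc or arise from joining spokes.\<close>

lemma penrose_replacement:
  assumes hes: "half_edge_system G'"
    and halfs: "halfs G' = I \<union> outer"
    and nxt: "\<And>h. h \<in> outer \<Longrightarrow> nxt G' h = nxt G h"
    and opp: "\<And>h. h \<in> T \<Longrightarrow> opp G' h = opp G h" "\<And>h. h \<in> T \<Longrightarrow> twist G' h = twist G h"
    and K: "transversal G' (T \<union> K)" "T \<inter> K = {}"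
    and no_isolated': "verts G' \<subseteq> base G' ` halfs G'"
  shows "poly (penrose G') (int CARD('c::finite)) =
    (\<Sum>x \<in> I \<union> outer \<rightarrow>\<^sub>E (UNIV :: 'c set). outer_weight G T x * (\<Prod>h\<in>K. strand_at G' x h))"
proof -
  interpret G': half_edge_system G'
    by fact
  have prev: "prev_half G' h = prev_half G h" if "h \<in> outer" for h
    using prev_outer[OF that] nxt[OF prev_outer[OF that]] nxt_prev[OF outer_in[OF that]] halfs
    by (intro G'.prev_half_eq) auto
  have fin: "finite (T \<union> K)"
    using K(1) G'.finite_halfs finite_subset by (auto simp: transversal_def)
  have "(\<Prod>h\<in>T \<union> K. strand_at G' x h) = outer_weight G T x * (\<Prod>h\<in>K. strand_at G' x h)" for x :: "'h \<Rightarrow> 'c"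
  proof -
    have "(\<Prod>h\<in>T. strand_at G' x h) = outer_weight G T x"
      unfolding outer_weight_def
      by (intro prod.cong) (simp_all add: strand_at_def opp prev T_in_outer)
    then show ?thesis
      using fin K(2) by (simp add: prod.union_disjoint)
  qed
  then show ?thesis
    using G'.penrose_state_sum[OF K(1) no_isolated', where 'c = 'c] by (simp add: halfs)
qed

lemma prev_replacement:
  assumes "half_edge_system G'" "halfs G' = I \<union> outer" "\<And>h. h \<in> outer \<Longrightarrow> nxt G' h = nxt G h" "h \<in> outer"
  shows "prev_half G' h = prev_half G h"
  using half_edge_system.prev_half_eq[OF assms(1)] prev_outer[OF assms(4)] assms(2,3)
    nxt_prev[OF outer_in[OF assms(4)]] by auto

lemma outer_vert:
  assumes "v \<in> verts G" "v \<notin> quad_verts G s1 s2 s3 s4"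
  shows "v \<in> base G ` outer"
  using assms no_isolated by (auto simp: outer_halfs_def)

text \<open>No corner is left inside, so there is no inner sum. Each joined edge is a strand between
  far ends, that is -1/2 times a pairing; the factor 4 clears the two denominators.\<close>

lemma penrose_join:
  "poly (penrose (join_spokes G s1 s2 s3 s4)) (int CARD('c::finite)) * 4 =
    (\<Sum>y \<in> outer \<rightarrow>\<^sub>E (UNIV :: 'c set).
       outer_weight G T y * (pairing (spoke G y s1) (spoke G y s2) * pairing (spoke G y s3) (spoke G y s4)))"
proof -
  let ?G' = "join_spokes G s1 s2 s3 s4"
  let ?t1 = "opp G s1" and ?t2 = "opp G s2" and ?t3 = "opp G s3" and ?t4 = "opp G s4"
  have dist: "distinct [?t1, ?t2, ?t3, ?t4]"
    using spokes_distinct opp_opp_spokes by (metis distinct_length_2_or_more distinct_singleton)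
  have rec: "halfs ?G' = {} \<union> outer" "nxt ?G' = nxt G" "base ?G' = base G"
      "verts ?G' = verts G - quad_verts G s1 s2 s3 s4"
      "opp ?G' = (opp G)(?t1 := ?t2, ?t2 := ?t1, ?t3 := ?t4, ?t4 := ?t3)"
      "twist ?G' = (twist G)(?t1 := twist G s1 \<noteq> twist G s2, ?t2 := twist G s1 \<noteq> twist G s2,
         ?t3 := twist G s3 \<noteq> twist G s4, ?t4 := twist G s3 \<noteq> twist G s4)"
    by (simp_all add: join_spokes_def Let_def)
  have hes: "half_edge_system ?G'"
  proof (rule replacement_half_edge_system[where I = "{}"])
    fix h assume "h \<in> halfs ?G'"
    then have h: "h \<in> outer" by (simp add: rec)
    show "opp ?G' h \<in> halfs ?G' \<and> opp ?G' (opp ?G' h) = h \<and> twist ?G' (opp ?G' h) = twist ?G' h"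
    proof (cases "h \<in> opp G ` {s1, s2, s3, s4}")
      case True
      then show ?thesis
        using dist opp_spokes_outer by (auto simp: rec)
    next
      case False
      then show ?thesis
        using opp_outer'[OF h False] h outer_in[OF h] by (auto simp: rec opp_opp twist_opp)
    qed
  qed (simp_all add: rec bij_betw_def)
  have T: "h \<in> T \<Longrightarrow> h \<noteq> ?t1 \<and> h \<noteq> ?t2 \<and> h \<noteq> ?t3 \<and> h \<noteq> ?t4" for h
    using T_outer by auto
  have trans: "transversal ?G' (T \<union> {?t1, ?t3})"
    unfolding transversal_def
  proof (intro conjI ballI)
    show "T \<union> {?t1, ?t3} \<subseteq> halfs ?G'"
      using T_outer opp_spokes_outer by (auto simp: rec)
    fix h assume "h \<in> halfs ?G'"
    then have h: "h \<in> outer" by (simp add: rec)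
    show "opp ?G' h \<in> T \<union> {?t1, ?t3} \<longleftrightarrow> h \<notin> T \<union> {?t1, ?t3}"
    proof (cases "h \<in> opp G ` {s1, s2, s3, s4}")
      case True
      then show ?thesis
        using dist T by (auto simp: rec)
    next
      case False
      then show ?thesis
        using opp_outer'[OF h False] T_transversal[of h] h by (auto simp: rec)
    qed
  qed
  have "verts ?G' \<subseteq> base ?G' ` halfs ?G'"
    using outer_vert by (auto simp: rec)
  then have "poly (penrose ?G') (int CARD('c)) = (\<Sum>x \<in> {} \<union> outer \<rightarrow>\<^sub>E (UNIV :: 'c set).
      outer_weight G T x * (\<Prod>h\<in>{?t1, ?t3}. strand_at ?G' x h))"
    using T by (intro penrose_replacement[OF hes rec(1) _ _ _ trans]) (auto simp: rec)
  moreover have "(\<Prod>h\<in>{?t1, ?t3}. strand_at ?G' x h) * 4 =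
      pairing (spoke G x s1) (spoke G x s2) * pairing (spoke G x s3) (spoke G x s4)" for x :: "'h \<Rightarrow> 'c"
  proof -
    have prev: "prev_half ?G' h = prev_half G h" if "h \<in> outer" for h
      using prev_replacement[OF hes rec(1) _ that] by (simp add: rec)
    have "strand_at ?G' x ?t1 = strand (twist G s1 \<noteq> twist G s2)
         (x ?t1) (x (prev_half G ?t1)) (x ?t2) (x (prev_half G ?t2))"
      "strand_at ?G' x ?t3 = strand (twist G s3 \<noteq> twist G s4)
         (x ?t3) (x (prev_half G ?t3)) (x ?t4) (x (prev_half G ?t4))"
      using dist by (simp_all add: strand_at_def rec opp_spokes_outer[THEN prev])
    then show ?thesis
      using dist by (simp add: spoke_def[abs_def] pairing_strand)
  qed
  ultimately show ?thesis
    by (simp add: sum_distrib_right mult.assoc)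
qed

text \<open>Common to the square, \<open>H\<close> and the 4-valent vertex, where the four spokes
  survive as edges. They are represented by their inner halves, and \<open>K\<close> represents the
  edges inside the disc.\<close>

lemma spoked_replacement:
  assumes halfs: "halfs G' = I \<union> outer" "I \<inter> outer = {}" "finite I" "{s1, s2, s3, s4} \<subseteq> I"
    and nxt: "\<And>h. h \<in> outer \<Longrightarrow> nxt G' h = nxt G h" "bij_betw (nxt G') I I"
    and opp: "\<And>h. h \<in> outer \<union> {s1, s2, s3, s4} \<Longrightarrow> opp G' h = opp G h"
      "\<And>h. h \<in> outer \<union> {s1, s2, s3, s4} \<Longrightarrow> twist G' h = twist G h"
    and inner: "\<And>h. h \<in> I - {s1, s2, s3, s4} \<Longrightarrow>
      opp G' h \<in> I - {s1, s2, s3, s4} \<and> opp G' (opp G' h) = h \<and> twist G' (opp G' h) = twist G' h \<and>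
      (opp G' h \<in> K \<longleftrightarrow> h \<notin> K)"
    and K: "K \<subseteq> I - {s1, s2, s3, s4}"
    and no_isolated': "verts G' \<subseteq> base G' ` halfs G'"
  shows "half_edge_system G'"
    and "poly (penrose G') (int CARD('c::finite)) =
      (\<Sum>x \<in> I \<union> outer \<rightarrow>\<^sub>E (UNIV :: 'c set). outer_weight G T x *
        (spoke G x s1 (x s1) (x (prev_half G' s1)) * spoke G x s2 (x s2) (x (prev_half G' s2)) *
         spoke G x s3 (x s3) (x (prev_half G' s3)) * spoke G x s4 (x s4) (x (prev_half G' s4)) *
         (\<Prod>h\<in>K. strand_at G' x h)))"
proof -
  have opp_outer_S: "opp G h \<in> outer \<union> {s1, s2, s3, s4}" if "h \<in> outer \<union> {s1, s2, s3, s4}" for h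
    using that opp_outer opp_spokes_outer by blast
  have halfs_cases: "h \<in> I - {s1, s2, s3, s4} \<or> h \<in> outer \<union> {s1, s2, s3, s4}" if "h \<in> halfs G'" for h
    using that halfs by auto
  show hes: "half_edge_system G'"
  proof (rule replacement_half_edge_system[OF halfs(1-3) nxt])
    fix h assume "h \<in> halfs G'"
    then consider "h \<in> I - {s1, s2, s3, s4}" | "h \<in> outer \<union> {s1, s2, s3, s4}"
      using halfs_cases by blast
    then show "opp G' h \<in> halfs G' \<and> opp G' (opp G' h) = h \<and> twist G' (opp G' h) = twist G' h"
    proof cases
      case 1
      then show ?thesis
        using inner[OF 1] halfs by blast
    next
      case 2
      moreover have "h \<in> halfs G"
        using 2 outer_in spokes_in by blast
      ultimately show ?thesis
        using opp_outer_S[OF 2] halfs by (auto simp: opp opp_opp twist_opp)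
    qed
  qed
  have "transversal G' (T \<union> ({s1, s2, s3, s4} \<union> K))"
    unfolding transversal_def
  proof (intro conjI ballI)
    show "T \<union> ({s1, s2, s3, s4} \<union> K) \<subseteq> halfs G'"
      using T_outer halfs K by auto
    have disj: "h \<notin> K" "h \<notin> I - {s1, s2, s3, s4}" if "h \<in> outer \<union> {s1, s2, s3, s4}" for h
      using that K halfs(2) by auto
    fix h assume "h \<in> halfs G'"
    then consider "h \<in> I - {s1, s2, s3, s4}" | "h \<in> {s1, s2, s3, s4}"
      | "h \<in> opp G ` {s1, s2, s3, s4}" | "h \<in> outer - opp G ` {s1, s2, s3, s4}"
      using halfs_cases by blast
    then show "opp G' h \<in> T \<union> ({s1, s2, s3, s4} \<union> K) \<longleftrightarrow> h \<notin> T \<union> ({s1, s2, s3, s4} \<union> K)"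
    proof cases
      case 1
      then have "h \<notin> T" "opp G' h \<notin> T"
        using inner[OF 1] T_outer halfs(2) by blast+
      then show ?thesis
        using 1 inner[OF 1] by blast
    next
      case 2
      then have "opp G h \<in> outer" "opp G h \<notin> T"
        using T_outer opp_spokes by auto
      then show ?thesis
        using 2 spokes_not_outer opp(1)[of h] disj(1)[of "opp G h"] by auto
    next
      case 3
      then have "opp G h \<in> {s1, s2, s3, s4}" "h \<in> outer" "h \<notin> T"
        using T_outer opp_spokes opp_opp_spokes by auto
      then show ?thesis
        using spokes_not_outer opp(1)[of h] disj(1)[of h] by auto
    next
      case 4
      then have "opp G h \<in> outer" "opp G' h = opp G h" "h \<notin> K" "opp G h \<notin> K"
        using opp_outer'[of h] opp(1)[of h] disj(1) by blast+
      then show ?thesis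
        using 4 T_transversal[of h] spokes_not_outer by auto
    qed
  qed
  moreover have "T \<inter> ({s1, s2, s3, s4} \<union> K) = {}"
    using T_outer halfs(2) K spokes_not_outer by blast
  ultimately have "poly (penrose G') (int CARD('c)) = (\<Sum>x \<in> I \<union> outer \<rightarrow>\<^sub>E (UNIV :: 'c set).
      outer_weight G T x * (\<Prod>h\<in>{s1, s2, s3, s4} \<union> K. strand_at G' x h))"
    using no_isolated' T_in_outer opp by (intro penrose_replacement[OF hes halfs(1) nxt(1)]) auto
  moreover have "(\<Prod>h\<in>{s1, s2, s3, s4} \<union> K. strand_at G' x h) =
      spoke G x s1 (x s1) (x (prev_half G' s1)) * spoke G x s2 (x s2) (x (prev_half G' s2)) *
      spoke G x s3 (x s3) (x (prev_half G' s3)) * spoke G x s4 (x s4) (x (prev_half G' s4)) *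
      (\<Prod>h\<in>K. strand_at G' x h)" for x :: "'h \<Rightarrow> 'c"
  proof -
    have "strand_at G' x s = spoke G x s (x s) (x (prev_half G' s))" if "s \<in> {s1, s2, s3, s4}" for s
    proof -
      have "opp G s \<in> outer"
        using that opp_spokes by blast
      then have "prev_half G' (opp G s) = prev_half G (opp G s)"
        by (intro prev_replacement[OF hes halfs(1)] nxt(1))
      moreover have "opp G' s = opp G s" "twist G' s = twist G s"
        using that opp by blast+
      ultimately show ?thesis
        by (simp add: strand_at_def spoke_def)
    qed
    moreover have "finite K" "{s1, s2, s3, s4} \<inter> K = {}"
      using K halfs(3) finite_subset by blast+
    ultimately show ?thesis
      by (subst prod.union_disjoint) (simp_all add: spokes_neq)
  qed
  ultimately show "poly (penrose G') (int CARD('c::finite)) =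
      (\<Sum>x \<in> I \<union> outer \<rightarrow>\<^sub>E (UNIV :: 'c set). outer_weight G T x *
        (spoke G x s1 (x s1) (x (prev_half G' s1)) * spoke G x s2 (x s2) (x (prev_half G' s2)) *
         spoke G x s3 (x s3) (x (prev_half G' s3)) * spoke G x s4 (x s4) (x (prev_half G' s4)) *
         (\<Prod>h\<in>K. strand_at G' x h)))"
    by simp
qed

lemma penrose_vertex:
  "poly (penrose (replace_vertex G s1 s2 s3 s4)) (int CARD('c::finite)) =
    (\<Sum>y \<in> outer \<rightarrow>\<^sub>E (UNIV :: 'c set).
       outer_weight G T y * vertex_sum (spoke G y s1) (spoke G y s2) (spoke G y s3) (spoke G y s4))"
proof -
  let ?G' = "replace_vertex G s1 s2 s3 s4"
  let ?I = "{s4, s3, s2, s1}"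
  have rec: "halfs ?G' = ?I \<union> outer" "nxt ?G' = (nxt G)(s1 := s2, s2 := s3, s3 := s4, s4 := s1)"
      "base ?G' = (base G)(s1 := base G s1, s2 := base G s1, s3 := base G s1, s4 := base G s1)"
      "verts ?G' = verts G - quad_verts G s1 s2 s3 s4 \<union> {base G s1}"
      "opp ?G' = opp G" "twist ?G' = twist G"
    by (auto simp: replace_vertex_def Let_def)
  have nxt: "nxt ?G' h = nxt G h" if "h \<in> outer" for h
    using that spokes_not_outer by (auto simp: rec)
  have bij: "bij_betw (nxt ?G') ?I ?I"
    using spokes_distinct by (auto simp: rec bij_betw_def inj_on_def)
  have "v \<in> base ?G' ` halfs ?G'" if v: "v \<in> verts ?G'" for v
  proof (cases "v = base G s1")
    case False
    then obtain h where "h \<in> outer" "v = base G h"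
      using v outer_vert by (auto simp: rec)
    then show ?thesis
      using spokes_not_outer by (intro image_eqI[of _ _ h]) (auto simp: rec)
  qed (intro image_eqI[of _ _ s1], auto simp: rec)
  then have verts: "verts ?G' \<subseteq> base ?G' ` halfs ?G'"
    by blast
  have hes: "half_edge_system ?G'"
    by (rule spoked_replacement(1)[OF rec(1) _ _ _ nxt bij, where K = "{}"])
       (use spokes_not_outer verts in \<open>auto simp: rec(5,6)\<close>)
  have prev: "prev_half ?G' s1 = s4" "prev_half ?G' s2 = s1" "prev_half ?G' s3 = s2" "prev_half ?G' s4 = s3"
    by (auto intro!: half_edge_system.prev_half_eq[OF hes] simp: rec spokes_neq)
  have "poly (penrose ?G') (int CARD('c)) = (\<Sum>x \<in> ?I \<union> outer \<rightarrow>\<^sub>E (UNIV :: 'c set). outer_weight G T x *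
      (spoke G x s1 (x s1) (x (prev_half ?G' s1)) * spoke G x s2 (x s2) (x (prev_half ?G' s2)) *
       spoke G x s3 (x s3) (x (prev_half ?G' s3)) * spoke G x s4 (x s4) (x (prev_half ?G' s4)) *
       (\<Prod>h\<in>{}. strand_at ?G' x h)))"
    by (rule spoked_replacement(2)[OF rec(1) _ _ _ nxt bij])
       (use spokes_not_outer verts in \<open>auto simp: rec(5,6)\<close>)
  then show ?thesis
    by (simp add: prev sum_PiE_insert vertex_sum_def sum_distrib_left spokes_neq spokes_not_outer)
qed

text \<open>The halves of the new edge reuse the names \<open>nxt G s1\<close> and
  \<open>nxt G s3\<close>; the assumption keeps these apart from each other and from the
  spokes.\<close>

lemma penrose_H:
  assumes dist: "distinct [s1, s2, s3, s4, nxt G s1, nxt G s3]"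
  shows "poly (penrose (replace_H G s1 s2 s3 s4)) (int CARD('c::finite)) =
    (\<Sum>y \<in> outer \<rightarrow>\<^sub>E (UNIV :: 'c set).
       outer_weight G T y * H_sum (spoke G y s1) (spoke G y s2) (spoke G y s3) (spoke G y s4))"
proof -
  let ?G' = "replace_H G s1 s2 s3 s4"
  define f f' where "f = nxt G s1" and "f' = nxt G s3"
  let ?I = "{f', f, s4, s3, s2, s1}"
  have neq: "f \<noteq> s1" "f \<noteq> s2" "f \<noteq> s3" "f \<noteq> s4" "f' \<noteq> s1" "f' \<noteq> s2" "f' \<noteq> s3" "f' \<noteq> s4" "f \<noteq> f'" "f' \<noteq> f"
      "s1 \<noteq> f" "s2 \<noteq> f" "s3 \<noteq> f" "s4 \<noteq> f" "s1 \<noteq> f'" "s2 \<noteq> f'" "s3 \<noteq> f'" "s4 \<noteq> f'"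
    using dist by (auto simp: f_def f'_def)
  have f_outer: "f \<notin> outer" "f' \<notin> outer"
    using spokes_in by (auto simp: f_def f'_def outer_halfs_def quad_verts_def base_nxt)
  have rec: "halfs ?G' = ?I \<union> outer"
      "nxt ?G' = (nxt G)(s1 := s2, s2 := f, f := s1, s3 := s4, s4 := f', f' := s3)"
      "base ?G' = (base G)(s1 := base G s1, s2 := base G s1, f := base G s1,
         s3 := base G s3, s4 := base G s3, f' := base G s3)"
      "verts ?G' = verts G - quad_verts G s1 s2 s3 s4 \<union> {base G s1, base G s3}"
      "opp ?G' = (opp G)(f := f', f' := f)" "twist ?G' = (twist G)(f := False, f' := False)"
    by (auto simp: replace_H_def Let_def f_def f'_def)
  have nxt: "nxt ?G' h = nxt G h" if "h \<in> outer" for h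
    using that spokes_not_outer f_outer by (auto simp: rec)
  have bij: "bij_betw (nxt ?G') ?I ?I"
    using spokes_neq neq by (auto simp: rec bij_betw_def inj_on_def)
  have "v \<in> base ?G' ` halfs ?G'" if v: "v \<in> verts ?G'" for v
  proof -
    consider "v = base G s1" | "v = base G s3" | "v \<in> verts G" "v \<notin> quad_verts G s1 s2 s3 s4"
      using v by (auto simp: rec)
    then show ?thesis
    proof cases
      case 1
      then show ?thesis
        by (intro image_eqI[of _ _ s1]) (simp_all add: rec neq spokes_neq)
    next
      case 2
      then show ?thesis
        by (intro image_eqI[of _ _ s3]) (simp_all add: rec neq spokes_neq)
    next
      case 3
      then obtain h where "h \<in> outer" "v = base G h"
        using outer_vert by auto
      then show ?thesis
        using spokes_not_outer f_outer by (intro image_eqI[of _ _ h]) (auto simp: rec)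
    qed
  qed
  then have verts: "verts ?G' \<subseteq> base ?G' ` halfs ?G'"
    by blast
  have opp: "opp ?G' h = opp G h" "twist ?G' h = twist G h" if "h \<in> outer \<union> {s1, s2, s3, s4}" for h
    using that f_outer neq by (auto simp: rec)
  have inner: "opp ?G' h \<in> ?I - {s1, s2, s3, s4} \<and> opp ?G' (opp ?G' h) = h \<and>
      twist ?G' (opp ?G' h) = twist ?G' h \<and> (opp ?G' h \<in> {f} \<longleftrightarrow> h \<notin> {f})"
    if "h \<in> ?I - {s1, s2, s3, s4}" for h
    using that neq by (auto simp: rec)
  have side: "?I \<inter> outer = {}" "finite ?I" "{s1, s2, s3, s4} \<subseteq> ?I" "{f} \<subseteq> ?I - {s1, s2, s3, s4}"
    using spokes_not_outer f_outer neq by auto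
  have hes: "half_edge_system ?G'"
    by (rule spoked_replacement(1)[OF rec(1) side(1-3) nxt bij opp inner side(4) verts])
  have prev: "prev_half ?G' s1 = f" "prev_half ?G' s2 = s1" "prev_half ?G' f = s2"
      "prev_half ?G' s3 = f'" "prev_half ?G' s4 = s3" "prev_half ?G' f' = s4"
    by (auto intro!: half_edge_system.prev_half_eq[OF hes] simp: rec spokes_neq neq)
  have "poly (penrose ?G') (int CARD('c)) = (\<Sum>x \<in> ?I \<union> outer \<rightarrow>\<^sub>E (UNIV :: 'c set). outer_weight G T x *
      (spoke G x s1 (x s1) (x (prev_half ?G' s1)) * spoke G x s2 (x s2) (x (prev_half ?G' s2)) *
       spoke G x s3 (x s3) (x (prev_half ?G' s3)) * spoke G x s4 (x s4) (x (prev_half ?G' s4)) *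
       (\<Prod>h\<in>{f}. strand_at ?G' x h)))"
    by (rule spoked_replacement(2)[OF rec(1) side(1-3) nxt bij opp inner side(4) verts])
  moreover have "strand_at ?G' x f = strand False (x f) (x s2) (x f') (x s4)" for x :: "'h \<Rightarrow> 'c"
    using neq by (simp add: strand_at_def prev rec(5,6))
  ultimately show ?thesis
    by (simp add: prev sum_PiE_insert H_sum_def sum_distrib_left spokes_neq neq spokes_not_outer f_outer)
qed

end

section \<open>The quadrilateral\<close>

lemma outer_halfs_image: "outer_halfs G a b c d = {h \<in> halfs G. base G h \<notin> base G ` {a, b, c, d}}"
  by (simp add: outer_halfs_def quad_verts_def)

text \<open>Configuration \<open>I\<close> is \<open>H\<close> with the spokes rotated, and the
  three ways of joining spokes differ by a permutation, so one evaluation of each kind is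
  enough.\<close>

lemma four_spokes_permute:
  assumes "four_spokes G s1 s2 s3 s4 T" "{a, b, c, d} = {s1, s2, s3, s4}" "distinct [a, b, c, d]"
  shows "four_spokes G a b c d T"
proof -
  interpret four_spokes G s1 s2 s3 s4 T
    by fact
  have "outer_halfs G a b c d = outer"
    unfolding outer_halfs_image assms(2) ..
  then show ?thesis
    using no_isolated spokes_in opp_spokes opp_outer T_outer T_transversal assms(3)
    unfolding assms(2)[symmetric] by unfold_locales auto
qed

text \<open>The orbit of \<open>x\<close> under \<open>nxt\<close> stays in \<open>{x, y, z}\<close>
  and exhausts the half-edges at the vertex; having three of them forces distinctness.\<close>

lemma (in ribbon_graph) rotation3_fibre:
  assumes "trivalent G" "x \<in> halfs G" "rotation3 G x y z"
  shows "{h \<in> halfs G. base G h = base G x} = {x, y, z}" "distinct [x, y, z]"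
proof -
  have "(nxt G ^^ i) x \<in> {x, y, z}" for i
    by (induction i) (use assms(3) in \<open>auto simp: rotation3_def\<close>)
  then have "{h \<in> halfs G. base G h = base G x} \<subseteq> {x, y, z}"
    using nxt_cyclic[OF assms(2)] by (auto, metis)
  moreover have "{x, y, z} \<subseteq> {h \<in> halfs G. base G h = base G x}"
    using assms(2,3) nxt_in base_nxt unfolding rotation3_def by auto
  ultimately show fibre: "{h \<in> halfs G. base G h = base G x} = {x, y, z}"
    by blast
  have "card {h \<in> halfs G. base G h = base G x} = 3"
    using assms(1,2) base_in by (simp add: trivalent_def)
  then have "card (set [x, y, z]) = length [x, y, z]"
    unfolding fibre by simp
  then show "distinct [x, y, z]"
    by (rule card_distinct)
qed

section \<open>Half-edges inside and outside the quadrilateral\<close>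

locale quadrilateral = ribbon_graph G
  for G :: "('v, 'h) rgraph" +
  fixes s1 s2 s3 s4 c1 c2 c3 c4 :: 'h
  assumes triv: "trivalent G"
    and s_in: "{s1, s2, s3, s4} \<subseteq> halfs G"
    and corners: "distinct [base G s1, base G s2, base G s3, base G s4]"
    and rot: "rotation3 G s1 c1 (opp G c4)" "rotation3 G s2 c2 (opp G c1)"
      "rotation3 G s3 c3 (opp G c2)" "rotation3 G s4 c4 (opp G c3)"
    and untwisted: "\<not> twist G c1" "\<not> twist G c2" "\<not> twist G c3" "\<not> twist G c4"
    and spoke_edges: "distinct [edge_of G s1, edge_of G s2, edge_of G s3, edge_of G s4]"
begin

text \<open>Listed from the innermost to the outermost summation variable of
  \<open>square_sum\<close>.\<close>

abbreviation inner :: "'h set" where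
  "inner \<equiv> {opp G c3, opp G c2, opp G c1, opp G c4, c3, s3, c1, s1, c2, s2, c4, s4}"

lemma fibres:
  "{h \<in> halfs G. base G h = base G s1} = {s1, c1, opp G c4}"
  "{h \<in> halfs G. base G h = base G s2} = {s2, c2, opp G c1}"
  "{h \<in> halfs G. base G h = base G s3} = {s3, c3, opp G c2}"
  "{h \<in> halfs G. base G h = base G s4} = {s4, c4, opp G c3}"
  using rotation3_fibre(1)[OF triv _ rot(1)] rotation3_fibre(1)[OF triv _ rot(2)]
    rotation3_fibre(1)[OF triv _ rot(3)] rotation3_fibre(1)[OF triv _ rot(4)] s_in by auto

lemma inner_distinct:
  "distinct [s1, c1, opp G c4, s2, c2, opp G c1, s3, c3, opp G c2, s4, c4, opp G c3]"
proof -
  have "distinct [s1, c1, opp G c4]" "distinct [s2, c2, opp G c1]"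
    "distinct [s3, c3, opp G c2]" "distinct [s4, c4, opp G c3]"
    using rotation3_fibre(2)[OF triv _ rot(1)] rotation3_fibre(2)[OF triv _ rot(2)]
      rotation3_fibre(2)[OF triv _ rot(3)] rotation3_fibre(2)[OF triv _ rot(4)] s_in by auto
  moreover have "{s1, c1, opp G c4} \<inter> {s2, c2, opp G c1} = {}" "{s1, c1, opp G c4} \<inter> {s3, c3, opp G c2} = {}"
    "{s1, c1, opp G c4} \<inter> {s4, c4, opp G c3} = {}" "{s2, c2, opp G c1} \<inter> {s3, c3, opp G c2} = {}"
    "{s2, c2, opp G c1} \<inter> {s4, c4, opp G c3} = {}" "{s3, c3, opp G c2} \<inter> {s4, c4, opp G c3} = {}"
    unfolding fibres[symmetric] using corners by auto
  ultimately show ?thesis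
    by auto
qed

lemma inner_fibre: "inner = {h \<in> halfs G. base G h \<in> quad_verts G s1 s2 s3 s4}"
proof -
  have "{h \<in> halfs G. base G h \<in> quad_verts G s1 s2 s3 s4} =
      {s1, c1, opp G c4} \<union> {s2, c2, opp G c1} \<union> {s3, c3, opp G c2} \<union> {s4, c4, opp G c3}"
    unfolding fibres[symmetric] quad_verts_def by blast
  then show ?thesis
    by (simp add: insert_commute)
qed

lemma halfs_inner_outer: "halfs G = inner \<union> outer_halfs G s1 s2 s3 s4"
    "inner \<inter> outer_halfs G s1 s2 s3 s4 = {}"
  unfolding inner_fibre outer_halfs_def by blast+

lemma inner_in: "h \<in> inner \<Longrightarrow> h \<in> halfs G"
  using halfs_inner_outer(1) by blast

lemma opp_opp_inner: "opp G (opp G c1) = c1" "opp G (opp G c2) = c2" "opp G (opp G c3) = c3"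
    "opp G (opp G c4) = c4" "opp G (opp G s1) = s1" "opp G (opp G s2) = s2" "opp G (opp G s3) = s3"
    "opp G (opp G s4) = s4"
  using inner_in by (auto intro: opp_opp)

text \<open>Distinctness of the spoke edges enters here: if \<open>opp G s\<close> were at the
  quadrilateral, it would be another spoke, so that two spokes share an edge, or half of some
  \<open>c_i\<close>, so that \<open>s\<close> itself would belong to that edge.\<close>

lemma opp_spoke_outer:
  assumes "s \<in> {s1, s2, s3, s4}"
  shows "opp G s \<in> outer_halfs G s1 s2 s3 s4"
proof (rule ccontr)
  assume "opp G s \<notin> outer_halfs G s1 s2 s3 s4"
  moreover have s: "s \<in> halfs G"
    using assms s_in by blast
  ultimately have "opp G s \<in> inner"
    using opp_in halfs_inner_outer(1) by blast
  then consider "opp G s \<in> {s1, s2, s3, s4}" | "opp G s \<in> {c1, c2, c3, c4}"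
    | "opp G s \<in> opp G ` {c1, c2, c3, c4}"
    by auto
  then show False
  proof cases
    case 1
    then have "edge_of G (opp G s) = edge_of G s" "opp G s \<noteq> s"
      using s by (auto simp: edge_of_def opp_opp opp_neq)
    moreover have "distinct (map (edge_of G) [s1, s2, s3, s4])"
      using spoke_edges by (simp only: list.map)
    then have "inj_on (edge_of G) {s1, s2, s3, s4}"
      by (simp only: distinct_map list.set)
    ultimately show ?thesis
      using 1 assms by (meson inj_onD)
  next
    case 2
    then have "s \<in> {opp G c1, opp G c2, opp G c3, opp G c4}"
      using opp_opp[OF s] by auto
    then show ?thesis
      using assms inner_distinct by auto
  next
    case 3
    then obtain c where c: "c \<in> {c1, c2, c3, c4}" "opp G s = opp G c"
      by blast
    then have "opp G (opp G c) = c"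
      using opp_opp_inner(1-4) by blast
    then have "s = c"
      using opp_opp[OF s] c(2) by simp
    then have "s \<in> {c1, c2, c3, c4}"
      using c(1) by simp
    then show ?thesis
      using assms inner_distinct by auto
  qed
qed

lemma opp_inner: "h \<in> inner - {s1, s2, s3, s4} \<Longrightarrow> opp G h \<in> inner - {s1, s2, s3, s4}"
  using inner_distinct opp_opp_inner by auto

lemma no_isolated_vert: "verts G \<subseteq> base G ` halfs G"
proof
  fix v assume "v \<in> verts G"
  then have "{h \<in> halfs G. base G h = v} \<noteq> {}"
    using triv by (auto simp: trivalent_def simp del: Collect_empty_eq)
  then show "v \<in> base G ` halfs G"
    by blast
qed

lemma opp_outer_cases:
  assumes "h \<in> outer_halfs G s1 s2 s3 s4"
  shows "opp G h \<in> outer_halfs G s1 s2 s3 s4 \<union> {s1, s2, s3, s4}"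
proof (rule ccontr)
  assume contra: "opp G h \<notin> outer_halfs G s1 s2 s3 s4 \<union> {s1, s2, s3, s4}"
  have h: "h \<in> halfs G"
    using assms by (simp add: outer_halfs_def)
  then have "opp G h \<in> inner - {s1, s2, s3, s4}"
    using contra opp_in[OF h] halfs_inner_outer(1) by blast
  then have "h \<in> inner"
    using opp_inner opp_opp[OF h] by fastforce
  then show False
    using assms halfs_inner_outer(2) by blast
qed

lemma exists_four_spokes: "\<exists>T. four_spokes G s1 s2 s3 s4 T"
proof -
  let ?O = "outer_halfs G s1 s2 s3 s4" and ?S = "{s1, s2, s3, s4}"
  have in_halfs: "h \<in> ?O \<Longrightarrow> h \<in> halfs G" for h
    by (simp add: outer_halfs_def)
  \<comment> \<open>Without the far halves of the spokes, the outer half-edges are closed under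
    \<open>opp\<close>, so a transversal of them exists.\<close>
  have "opp G h \<in> ?O - opp G ` ?S" if h: "h \<in> ?O - opp G ` ?S" for h
  proof -
    have hh: "opp G (opp G h) = h"
      using h in_halfs opp_opp by blast
    then have "opp G h \<notin> ?S"
      using h by (metis DiffD2 imageI)
    moreover have "opp G h \<notin> opp G ` ?S"
    proof
      assume "opp G h \<in> opp G ` ?S"
      then obtain s where s: "s \<in> ?S" "opp G h = opp G s"
        by blast
      then have "opp G (opp G s) = s"
        using s_in opp_opp by blast
      then have "h \<in> ?S"
        using hh s by simp
      then show False
        using h halfs_inner_outer(2) by blast
    qed
    ultimately show ?thesis
      using opp_outer_cases[of h] h by blast
  qed
  then obtain T where "T \<subseteq> ?O - opp G ` ?S" "\<forall>h \<in> ?O - opp G ` ?S. opp G h \<in> T \<longleftrightarrow> h \<notin> T"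
    using exists_transversal[of "?O - opp G ` ?S" "opp G"] opp_opp opp_neq in_halfs by (metis DiffD1)
  then have "four_spokes G s1 s2 s3 s4 T"
    using no_isolated_vert s_in inner_distinct opp_spoke_outer opp_outer_cases
    by unfold_locales auto
  then show ?thesis ..
qed

lemma penrose_square:
  assumes "four_spokes G s1 s2 s3 s4 T"
  shows "poly (penrose G) (int CARD('c::finite)) =
    (\<Sum>y \<in> outer_halfs G s1 s2 s3 s4 \<rightarrow>\<^sub>E (UNIV :: 'c set).
       outer_weight G T y * square_sum (spoke G y s1) (spoke G y s2) (spoke G y s3) (spoke G y s4))"
proof -
  interpret four_spokes G s1 s2 s3 s4 T
    by fact
  let ?S = "{s1, s2, s3, s4}"
  \<comment> \<open>The reversed list supplies every inequality in the opposite orientation for the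
    simplifier.\<close>
  have neq: "distinct [s1, c1, opp G c4, s2, c2, opp G c1, s3, c3, opp G c2, s4, c4, opp G c3]"
      "distinct [opp G c3, c4, s4, opp G c2, c3, s3, opp G c1, c2, s2, opp G c4, c1, s1]"
    using inner_distinct distinct_rev[of "[s1, c1, opp G c4, s2, c2, opp G c1, s3, c3, opp G c2, s4, c4, opp G c3]"]
    by (simp_all only: rev.simps append.simps)
  have "nxt G ` inner = inner"
    using rot by (auto simp: rotation3_def)
  moreover have "inj_on (nxt G) inner"
    using nxt_bij inner_in by (meson bij_betw_def inj_on_subset subsetI)
  ultimately have bij: "bij_betw (nxt G) inner inner"
    by (simp add: bij_betw_def)
  have K: "opp G h \<in> inner - ?S \<and> opp G (opp G h) = h \<and> twist G (opp G h) = twist G h \<and>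
      (opp G h \<in> {c1, c2, c3, c4} \<longleftrightarrow> h \<notin> {c1, c2, c3, c4})" if "h \<in> inner - ?S" for h
  proof (intro conjI)
    show "opp G h \<in> inner - ?S"
      using opp_inner[OF that] .
    show "opp G (opp G h) = h" "twist G (opp G h) = twist G h"
      using that inner_in[of h] by (auto simp: opp_opp twist_opp)
    show "opp G h \<in> {c1, c2, c3, c4} \<longleftrightarrow> h \<notin> {c1, c2, c3, c4}"
      using that inner_distinct opp_opp_inner by auto
  qed
  have side: "finite inner" "?S \<subseteq> inner" "{c1, c2, c3, c4} \<subseteq> inner - ?S"
    using inner_distinct by auto
  have "poly (penrose G) (int CARD('c)) = (\<Sum>x \<in> inner \<union> outer \<rightarrow>\<^sub>E (UNIV :: 'c set). outer_weight G T x *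
      (spoke G x s1 (x s1) (x (prev_half G s1)) * spoke G x s2 (x s2) (x (prev_half G s2)) *
       spoke G x s3 (x s3) (x (prev_half G s3)) * spoke G x s4 (x s4) (x (prev_half G s4)) *
       (\<Prod>h\<in>{c1, c2, c3, c4}. strand_at G x h)))"
    \<comment> \<open>The square is treated as its own replacement, with
      \<open>G' = G\<close>.\<close>
    by (rule spoked_replacement(2)[OF halfs_inner_outer side(1,2) refl bij refl refl K side(3) no_isolated])
  moreover have prev: "prev_half G s1 = opp G c4" "prev_half G c1 = s1" "prev_half G (opp G c1) = c2"
      "prev_half G s2 = opp G c1" "prev_half G c2 = s2" "prev_half G (opp G c2) = c3"
      "prev_half G s3 = opp G c2" "prev_half G c3 = s3" "prev_half G (opp G c3) = c4"
      "prev_half G s4 = opp G c3" "prev_half G c4 = s4" "prev_half G (opp G c4) = c1"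
    using rot inner_in by (auto intro!: prev_half_eq simp: rotation3_def)
  moreover have "(\<Prod>h\<in>{c1, c2, c3, c4}. strand_at G x h) =
      strand False (x c1) (x s1) (x (opp G c1)) (x c2) * strand False (x c2) (x s2) (x (opp G c2)) (x c3) *
      strand False (x c3) (x s3) (x (opp G c3)) (x c4) * strand False (x c4) (x s4) (x (opp G c4)) (x c1)"
    for x :: "'h \<Rightarrow> 'c"
    using inner_distinct by (simp add: strand_at_def prev untwisted)
  moreover have "h \<notin> outer" if "h \<in> inner" for h
    using that halfs_inner_outer(2) by blast
  then have "opp G c3 \<notin> outer" "opp G c2 \<notin> outer" "opp G c1 \<notin> outer" "opp G c4 \<notin> outer"
     "c3 \<notin> outer" "s3 \<notin> outer" "c1 \<notin> outer" "s1 \<notin> outer" "c2 \<notin> outer" "s2 \<notin> outer" "c4 \<notin> outer" "s4 \<notin> outer"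
    by simp_all
  ultimately show ?thesis
    using neq[unfolded distinct.simps list.set, simplified]
    by (simp add: sum_PiE_insert square_sum_def sum_distrib_left mult.assoc)
qed

end

theorem theorem3p6:
  fixes G :: "('v, 'h) rgraph" and s1 s2 s3 s4 :: 'h
  assumes "ribbon_graph G"
    and "trivalent G"
    and "connected_graph G"
    and "quadrilateral_face G s1 s2 s3 s4"
    and "distinct [edge_of G s1, edge_of G s2, edge_of G s3, edge_of G s4]"
  shows "poly (penrose G) 4 =
      2 * poly (penrose (replace_H G s1 s2 s3 s4)) 4
    + 2 * poly (penrose (replace_I G s1 s2 s3 s4)) 4
    + 4 * poly (penrose (replace_par G s1 s2 s3 s4)) 4
    + 4 * poly (penrose (replace_eq G s1 s2 s3 s4)) 4
    + 4 * poly (penrose (replace_cross G s1 s2 s3 s4)) 4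
    - 4 * poly (penrose (replace_vertex G s1 s2 s3 s4)) 4"
proof -
  obtain c1 c2 c3 c4 where c: "rotation3 G s1 c1 (opp G c4)" "rotation3 G s2 c2 (opp G c1)"
      "rotation3 G s3 c3 (opp G c2)" "rotation3 G s4 c4 (opp G c3)"
      "\<not> twist G c1" "\<not> twist G c2" "\<not> twist G c3" "\<not> twist G c4"
    using assms(4) unfolding quadrilateral_face_def by blast
  interpret quadrilateral G s1 s2 s3 s4 c1 c2 c3 c4
    using assms c by (intro quadrilateral.intro quadrilateral_axioms.intro) (auto simp: quadrilateral_face_def)
  obtain T where T: "four_spokes G s1 s2 s3 s4 T"
    using exists_four_spokes by blast
  let ?O = "outer_halfs G s1 s2 s3 s4"
  let ?C = "UNIV :: (bool \<times> bool) set"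
  \<comment> \<open>The four colours are the elements of \<open>bool \<times> bool\<close>.\<close>
  have four: "int CARD(bool \<times> bool) = 4"
    by simp
  have nxt: "nxt G s1 = c1" "nxt G s2 = c2" "nxt G s3 = c3" "nxt G s4 = c4"
    using c(1-4) by (simp_all add: rotation3_def)
  have dist: "distinct [s1, s2, s3, s4, nxt G s1, nxt G s3]" "distinct [s2, s3, s4, s1, nxt G s2, nxt G s4]"
    using inner_distinct unfolding nxt by auto
  have sets: "{s2, s3, s4, s1} = {s1, s2, s3, s4}" "{s1, s4, s2, s3} = {s1, s2, s3, s4}"
      "{s1, s3, s2, s4} = {s1, s2, s3, s4}"
    by blast+
  have spokes: "four_spokes G s2 s3 s4 s1 T" "four_spokes G s1 s4 s2 s3 T" "four_spokes G s1 s3 s2 s4 T"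
    by (rule four_spokes_permute[OF T sets(1)] four_spokes_permute[OF T sets(2)]
        four_spokes_permute[OF T sets(3)], use inner_distinct in auto)+
  have outer: "outer_halfs G s2 s3 s4 s1 = ?O" "outer_halfs G s1 s4 s2 s3 = ?O" "outer_halfs G s1 s3 s2 s4 = ?O"
    unfolding outer_halfs_image sets by (rule refl)+
  have "poly (penrose G) 4 = (\<Sum>y \<in> ?O \<rightarrow>\<^sub>E ?C. outer_weight G T y *
      square_sum (spoke G y s1) (spoke G y s2) (spoke G y s3) (spoke G y s4))"
    using penrose_square[OF T, where 'c = "bool \<times> bool"] unfolding four .
  \<comment> \<open>One instance of the trace identity for each outer colouring; summing it with the
    outer weights assembles the polynomials.\<close>
  also have "\<dots> = (\<Sum>y \<in> ?O \<rightarrow>\<^sub>E ?C.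
      2 * (outer_weight G T y * H_sum (spoke G y s1) (spoke G y s2) (spoke G y s3) (spoke G y s4))
    + 2 * (outer_weight G T y * H_sum (spoke G y s2) (spoke G y s3) (spoke G y s4) (spoke G y s1))
    + outer_weight G T y * (pairing (spoke G y s1) (spoke G y s4) * pairing (spoke G y s2) (spoke G y s3))
    + outer_weight G T y * (pairing (spoke G y s1) (spoke G y s2) * pairing (spoke G y s3) (spoke G y s4))
    + outer_weight G T y * (pairing (spoke G y s1) (spoke G y s3) * pairing (spoke G y s2) (spoke G y s4))
    - 4 * (outer_weight G T y * vertex_sum (spoke G y s1) (spoke G y s2) (spoke G y s3) (spoke G y s4)))"
    by (intro sum.cong refl, subst square_sum_identity) (simp_all add: antisym_fun_spoke algebra_simps)
  also have "\<dots> = 2 * poly (penrose (replace_H G s1 s2 s3 s4)) 4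
    + 2 * poly (penrose (replace_I G s1 s2 s3 s4)) 4
    + poly (penrose (replace_par G s1 s2 s3 s4)) 4 * 4
    + poly (penrose (replace_eq G s1 s2 s3 s4)) 4 * 4
    + poly (penrose (replace_cross G s1 s2 s3 s4)) 4 * 4
    - 4 * poly (penrose (replace_vertex G s1 s2 s3 s4)) 4"
    unfolding replace_I_def replace_par_def replace_eq_def replace_cross_def
    using four_spokes.penrose_H[OF T dist(1), where 'c = "bool \<times> bool"]
      four_spokes.penrose_H[OF spokes(1) dist(2), where 'c = "bool \<times> bool"]
      four_spokes.penrose_join[OF spokes(2), where 'c = "bool \<times> bool"]
      four_spokes.penrose_join[OF T, where 'c = "bool \<times> bool"]
      four_spokes.penrose_join[OF spokes(3), where 'c = "bool \<times> bool"]
      four_spokes.penrose_vertex[OF T, where 'c = "bool \<times> bool"]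
    unfolding four outer by (simp only: sum.distrib sum_subtractf sum_distrib_left)
  finally show ?thesis
    by simp
qed

end
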